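(* Let $\mathcal{M}$ be a deterministic 3-counter (Minsky) machine with initial state $q_S$, let $x$ be a natural number, and let $E$ and $D$ be the formulae associated with $\mathcal{M}$ as defined in the context. Then $\mathcal{M}$ runs forever on input $x$ if and only if the sequent $$E^*, q_S, \mathsf{a}^x \vdash D$$ is derivable in $\mathbf{CommACT}_\omega$. Therefore, the derivability problem for $\mathbf{CommACT}_\omega$ is $\Pi_1^0$-hard.
   Context: **Calculus.** Formulae are built from a countable set of variables and constants $\mathbf{0},\mathbf{1}$ using binary connectives $\multimap,\cdot,\vee,\wedge$ and the unary connective ${}^*$. A sequent is $\Gamma\vdash A$, where $\Gamma$ is a finite multiset of formulae (possibly empty) and $A$ is a formula. In antecedents, $A^n$ denotes $n$ copies of $A$. The calculus $\mathbf{CommACT}_\omega$ has the following axioms and rules. Axioms: $A\vdash A$; $\Gamma,\mathbf{0}\vdash C$; $\vdash\mathbf{1}$. Rules: ($\mathbf{1}L$) from $\Gamma\vdash C$ infer $\Gamma,\mathbf{1}\vdash C$; ($\multimap L$) from $\Pi\vdash A$ and $\Gamma,B\vdash C$ infer $\Gamma,\Pi,A\multimap B\vdash C$; ($\multimap R$) from $A,\Pi\vdash B$ infer $\Pi\vdash A\multimap B$; ($\cdot L$) from $\Gamma,A,B\vdash C$ infer $\Gamma,A\cdot B\vdash C$; ($\cdot R$) from $\Pi\vdash A$ and $\Delta\vdash B$ infer $\Pi,\Delta\vdash A\cdot B$; ($\vee L$) from $\Gamma,A\vdash C$ and $\Gamma,B\vdash C$ infer $\Gamma,A\vee B\vdash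 C$; ($\vee R$) from $\Pi\vdash A$ infer $\Pi\vdash A\vee B$; from $\Pi\vdash B$ infer $\Pi\vdash A\vee B$; ($\wedge L$) from $\Gamma,A\vdash C$ infer $\Gamma,A\wedge B\vdash C$; from $\Gamma,B\vdash C$ infer $\Gamma,A\wedge B\vdash C$; ($\wedge R$) from $\Pi\vdash A$ and $\Pi\vdash B$ infer $\Pi\vdash A\wedge B$; ($*L_\omega$) from the infinitely many premises $\Gamma,A^n\vdash C$ for all $n\ge 0$ infer $\Gamma,A^*\vdash C$; ($*R_n$, $n\ge 0$) from $\Pi_1\vdash A,\ \ldots,\ \Pi_n\vdash A$ infer $\Pi_1,\ldots,\Pi_n\vdash A^*$; (Cut) from $\Pi\vdash A$ and $\Gamma,A\vdash C$ infer $\Gamma,\Pi\vdash C$. The set of derivable sequents is the smallest set containing all axioms and closed under the rules. **Machines.** A 3-counter (Minsky) machine has three registers $\mathsf{a},\mathsf{b},\mathsf{c}$ holding natural numbers, a finite set of states $Q$ with an initial state $q_S$, and finitely many instructions of the forms: $\mathrm{INC}(p,r,q)$ (in state $p$, increase register $r$ by 1 and move to state $q$) and $\mathrm{JZDEC}(p,r,q_0,q_1)$ (in state $p$, if $r$ is $0$ move to state $q_0$; otherwise decrease $r$ by 1 and move to $q_1$). Machines are deterministic: for each state $p$ there is at most one instruction with first parameter $p$; moreover there is a unique state, the final state $q_F$, with no such instruction. The machine halts once it reaches $q_F$. On input $x$ it starts in state $q_S$ with register values $\mathsf{a}=x$, $\mathsf{b}=\mathsf{c}=0$; it runs forever on $x$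 if it never halts. **Encoding.** Take pairwise distinct variables: one for each state in $Q$, together with $\mathsf{a},\mathsf{b},\mathsf{c}$ and $z_{\mathsf{a}},z_{\mathsf{b}},z_{\mathsf{c}}$. Put $$A_{\mathrm{INC}(p,r,q)}=p\multimap(q\cdot r),\qquad A_{\mathrm{JZDEC}(p,r,q_0,q_1)}=((p\cdot r)\multimap q_1)\wedge(p\multimap(q_0\vee z_r)),$$ $N_r=z_r\multimap z_r$ for $r\in\{\mathsf{a},\mathsf{b},\mathsf{c}\}$, and $$E=N_{\mathsf{a}}\wedge N_{\mathsf{b}}\wedge N_{\mathsf{c}}\wedge\bigwedge_I A_I,$$ where $I$ ranges over the instructions of $\mathcal{M}$, and $$D=\bigl(\mathsf{a}^*\cdot\mathsf{b}^*\cdot\mathsf{c}^*\cdot\bigvee_{q\in Q}q\bigr)\vee(\mathsf{b}^*\cdot\mathsf{c}^*\cdot z_{\mathsf{a}})\vee(\mathsf{a}^*\cdot\mathsf{c}^*\cdot z_{\mathsf{b}})\vee(\mathsf{a}^*\cdot\mathsf{b}^*\cdot z_{\mathsf{c}}).$$ (Bracketing and order of iterated $\wedge,\vee,\cdot$ are fixed arbitrarily.) $\Pi_1^0$-hardness is with respect to many-one reductions, sequents being encoded by natural numbers in a standard computable way. *)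

theory Defs
  imports "HOL-Library.Multiset" "HOL-Library.Nat_Bijection"
begin

section \<open>The calculus\<close>

datatype fm =
    Var nat
  | Zero
  | One
  | Imp fm fm   (infixr "\<multimap>" 60)
  | Fuse fm fm  (infixr "\<odot>" 70)
  | Join fm fm  (infixr "\<^bold>\<or>" 64)
  | Meet fm fm  (infixr "\<^bold>\<and>" 66)
  | Star fm

inductive derivable :: "fm multiset \<Rightarrow> fm \<Rightarrow> bool"  (infix "\<turnstile>" 50) where
  Ax:    "{#A#} \<turnstile> A"
| ZeroL: "add_mset Zero \<Gamma> \<turnstile> C"
| OneR:  "{#} \<turnstile> One"
| OneL:  "\<Gamma> \<turnstile> C \<Longrightarrow> add_mset One \<Gamma> \<turnstile> C"
| ImpL:  "\<Pi> \<turnstile> A \<Longrightarrow> add_mset B \<Gamma> \<turnstile> C \<Longrightarrow> add_mset (A \<multimap> B) (\<Gamma> + \<Pi>) \<turnstile> C"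
| ImpR:  "add_mset A \<Pi> \<turnstile> B \<Longrightarrow> \<Pi> \<turnstile> A \<multimap> B"
| FuseL: "add_mset A (add_mset B \<Gamma>) \<turnstile> C \<Longrightarrow> add_mset (A \<odot> B) \<Gamma> \<turnstile> C"
| FuseR: "\<Pi> \<turnstile> A \<Longrightarrow> \<Delta> \<turnstile> B \<Longrightarrow> \<Pi> + \<Delta> \<turnstile> A \<odot> B"
| JoinL: "add_mset A \<Gamma> \<turnstile> C \<Longrightarrow> add_mset B \<Gamma> \<turnstile> C \<Longrightarrow> add_mset (A \<^bold>\<or> B) \<Gamma> \<turnstile> C"
| JoinR1: "\<Pi> \<turnstile> A \<Longrightarrow> \<Pi> \<turnstile> A \<^bold>\<or> B"
| JoinR2: "\<Pi> \<turnstile> B \<Longrightarrow> \<Pi> \<turnstile> A \<^bold>\<or> B"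
| MeetL1: "add_mset A \<Gamma> \<turnstile> C \<Longrightarrow> add_mset (A \<^bold>\<and> B) \<Gamma> \<turnstile> C"
| MeetL2: "add_mset B \<Gamma> \<turnstile> C \<Longrightarrow> add_mset (A \<^bold>\<and> B) \<Gamma> \<turnstile> C"
| MeetR: "\<Pi> \<turnstile> A \<Longrightarrow> \<Pi> \<turnstile> B \<Longrightarrow> \<Pi> \<turnstile> A \<^bold>\<and> B"
| StarL: "(\<And>n. \<Gamma> + replicate_mset n A \<turnstile> C) \<Longrightarrow> add_mset (Star A) \<Gamma> \<turnstile> C"
| StarR: "(\<And>\<Pi>. \<Pi> \<in> set \<Pi>s \<Longrightarrow> \<Pi> \<turnstile> A) \<Longrightarrow> sum_list \<Pi>s \<turnstile> Star A"
| Cut:   "\<Pi> \<turnstile> A \<Longrightarrow> add_mset A \<Gamma> \<turnstile> C \<Longrightarrow> \<Gamma> + \<Pi> \<turnstile> C"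


section \<open>Deterministic 3-counter machines\<close>

datatype reg = RegA | RegB | RegC

datatype 'q instr =
    INC 'q reg 'q
  | JZDEC 'q reg 'q 'q

fun instr_source :: "'q instr \<Rightarrow> 'q" where
  "instr_source (INC p r q) = p"
| "instr_source (JZDEC p r q0 q1) = p"

fun instr_states :: "'q instr \<Rightarrow> 'q set" where
  "instr_states (INC p r q) = {p, q}"
| "instr_states (JZDEC p r q0 q1) = {p, q0, q1}"

record 'q machine =
  states :: "'q set"
  init :: 'q
  final :: 'q
  instrs :: "'q instr set"

definition det_machine :: "'q machine \<Rightarrow> bool" where
  "det_machine M \<longleftrightarrow>
     finite (states M) \<and> init M \<in> states M \<and> final M \<in> states M \<and>
     finite (instrs M) \<and> (\<forall>i\<in>instrs M. instr_states i \<subseteq> states M) \<and>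
     inj_on instr_source (instrs M) \<and>
     (\<forall>p\<in>states M. p \<notin> instr_source ` instrs M \<longleftrightarrow> p = final M)"

type_synonym 'q config = "'q \<times> (reg \<Rightarrow> nat)"

inductive step :: "'q machine \<Rightarrow> 'q config \<Rightarrow> 'q config \<Rightarrow> bool" for M where
  "INC p r q \<in> instrs M \<Longrightarrow> step M (p, s) (q, s(r := s r + 1))"
| "JZDEC p r q0 q1 \<in> instrs M \<Longrightarrow> s r = 0 \<Longrightarrow> step M (p, s) (q0, s)"
| "JZDEC p r q0 q1 \<in> instrs M \<Longrightarrow> s r > 0 \<Longrightarrow> step M (p, s) (q1, s(r := s r - 1))"

definition initial_config :: "'q machine \<Rightarrow> nat \<Rightarrow> 'q config" where
  "initial_config M x = (init M, (\<lambda>r. 0)(RegA := x))"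

definition halts :: "'q machine \<Rightarrow> nat \<Rightarrow> bool" where
  "halts M x \<longleftrightarrow> (\<exists>s. (step M)\<^sup>*\<^sup>* (initial_config M x) (final M, s))"

definition runs_forever :: "'q machine \<Rightarrow> nat \<Rightarrow> bool" where
  "runs_forever M x \<longleftrightarrow> \<not> halts M x"


section \<open>The encoding of machines\<close>

text \<open>The variables are chosen by an assignment \<open>v\<close> of variable names to the roles they
  play: \<open>State q\<close> for the states, \<open>Reg r\<close> for the registers, \<open>ZTest r\<close> for the variables
  \<open>z\<^sub>r\<close>.\<close>

datatype 'q role = State 'q | Reg reg | ZTest reg

definition distinct_vars :: "'q machine \<Rightarrow> ('q role \<Rightarrow> nat) \<Rightarrow> bool" where
  "distinct_vars M v \<longleftrightarrow> inj_on v (State ` states M \<union> range Reg \<union> range ZTest)"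

abbreviation state_var :: "('q role \<Rightarrow> nat) \<Rightarrow> 'q \<Rightarrow> fm" where
  "state_var v q \<equiv> Var (v (State q))"

abbreviation reg_var :: "('q role \<Rightarrow> nat) \<Rightarrow> reg \<Rightarrow> fm" where
  "reg_var v r \<equiv> Var (v (Reg r))"

abbreviation ztest_var :: "('q role \<Rightarrow> nat) \<Rightarrow> reg \<Rightarrow> fm" where
  "ztest_var v r \<equiv> Var (v (ZTest r))"

text \<open>Iterated connectives, bracketed to the right; only used on nonempty lists.\<close>

primrec iterated :: "(fm \<Rightarrow> fm \<Rightarrow> fm) \<Rightarrow> fm list \<Rightarrow> fm" where
  "iterated c (A # As) = (if As = [] then A else c A (iterated c As))"

fun instr_fm :: "('q role \<Rightarrow> nat) \<Rightarrow> 'q instr \<Rightarrow> fm" where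
  "instr_fm v (INC p r q) = (state_var v p \<multimap> (state_var v q \<odot> reg_var v r))"
| "instr_fm v (JZDEC p r q0 q1) =
     (((state_var v p \<odot> reg_var v r) \<multimap> state_var v q1) \<^bold>\<and>
      (state_var v p \<multimap> (state_var v q0 \<^bold>\<or> ztest_var v r)))"

definition idle_fm :: "('q role \<Rightarrow> nat) \<Rightarrow> reg \<Rightarrow> fm" where
  "idle_fm v r = (ztest_var v r \<multimap> ztest_var v r)"

text \<open>The lists \<open>ins\<close> and \<open>qs\<close> are enumerations of the instructions and of the states;
  they fix the order of the iterated connectives.\<close>

definition E_fm :: "('q role \<Rightarrow> nat) \<Rightarrow> 'q instr list \<Rightarrow> fm" where
  "E_fm v ins =
     iterated Meet ([idle_fm v RegA, idle_fm v RegB, idle_fm v RegC] @ map (instr_fm v) ins)"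

definition D_fm :: "('q role \<Rightarrow> nat) \<Rightarrow> 'q list \<Rightarrow> fm" where
  "D_fm v qs =
     (let a = Star (reg_var v RegA); b = Star (reg_var v RegB); c = Star (reg_var v RegC) in
      (a \<odot> b \<odot> c \<odot> iterated Join (map (state_var v) qs)) \<^bold>\<or>
      (b \<odot> c \<odot> ztest_var v RegA) \<^bold>\<or>
      (a \<odot> c \<odot> ztest_var v RegB) \<^bold>\<or>
      (a \<odot> b \<odot> ztest_var v RegC))"


section \<open>Computability\<close>

text \<open>Partial recursive functions: \<open>evaluates f xs y\<close> means that \<open>f\<close> is defined on the
  arguments \<open>xs\<close> with value \<open>y\<close>.\<close>

datatype recf =
    Zr
  | Sc
  | Proj nat
  | Comp recf "recf list"
  | PrimRec recf recf
  | Mu recf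

inductive evaluates :: "recf \<Rightarrow> nat list \<Rightarrow> nat \<Rightarrow> bool" where
  "evaluates Zr xs 0"
| "evaluates Sc [x] (Suc x)"
| "i < length xs \<Longrightarrow> evaluates (Proj i) xs (xs ! i)"
| "list_all2 (\<lambda>g y. evaluates g xs y) gs ys \<Longrightarrow> evaluates f ys z \<Longrightarrow> evaluates (Comp f gs) xs z"
| "evaluates f xs y \<Longrightarrow> evaluates (PrimRec f g) (0 # xs) y"
| "evaluates (PrimRec f g) (n # xs) y \<Longrightarrow> evaluates g (n # y # xs) z
    \<Longrightarrow> evaluates (PrimRec f g) (Suc n # xs) z"
| "evaluates f (n # xs) 0 \<Longrightarrow> (\<And>k. k < n \<Longrightarrow> \<exists>y. evaluates f (k # xs) (Suc y))
    \<Longrightarrow> evaluates (Mu f) xs n"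

definition computable :: "(nat \<Rightarrow> nat) \<Rightarrow> bool" where
  "computable f \<longleftrightarrow> (\<exists>p. \<forall>x. evaluates p [x] (f x))"

definition decidable_rel :: "(nat \<Rightarrow> nat \<Rightarrow> bool) \<Rightarrow> bool" where
  "decidable_rel R \<longleftrightarrow> (\<exists>p. \<forall>x y. evaluates p [x, y] (if R x y then 1 else 0))"

definition Pi01 :: "nat set \<Rightarrow> bool" where
  "Pi01 S \<longleftrightarrow> (\<exists>R. decidable_rel R \<and> S = {x. \<forall>y. R x y})"

definition many_one_reducible :: "nat set \<Rightarrow> nat set \<Rightarrow> bool" where
  "many_one_reducible S T \<longleftrightarrow> (\<exists>f. computable f \<and> (\<forall>x. x \<in> S \<longleftrightarrow> f x \<in> T))"

definition Pi01_hard :: "nat set \<Rightarrow> bool" where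
  "Pi01_hard T \<longleftrightarrow> (\<forall>S. Pi01 S \<longrightarrow> many_one_reducible S T)"

primrec fm_code :: "fm \<Rightarrow> nat" where
  "fm_code (Var n) = prod_encode (0, n)"
| "fm_code Zero = prod_encode (1, 0)"
| "fm_code One = prod_encode (2, 0)"
| "fm_code (A \<multimap> B) = prod_encode (3, prod_encode (fm_code A, fm_code B))"
| "fm_code (A \<odot> B) = prod_encode (4, prod_encode (fm_code A, fm_code B))"
| "fm_code (A \<^bold>\<or> B) = prod_encode (5, prod_encode (fm_code A, fm_code B))"
| "fm_code (A \<^bold>\<and> B) = prod_encode (6, prod_encode (fm_code A, fm_code B))"
| "fm_code (Star A) = prod_encode (7, fm_code A)"

text \<open>The antecedent is coded through a list of its formulae in any order, so a sequent has
  a code for each such list.\<close>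

definition sequent_code :: "fm list \<Rightarrow> fm \<Rightarrow> nat" where
  "sequent_code As C = prod_encode (list_encode (map fm_code As), fm_code C)"

definition derivability_problem :: "nat set" where
  "derivability_problem = {sequent_code As C | As C. mset As \<turnstile> C}"

end

theory Submission
  imports Defs "HOL-Library.Set_Algebras" "HOL-Library.Function_Algebras" "HOL-Library.Product_Plus"
    "HOL-Library.Infinite_Set" "HOL-Computational_Algebra.Primes"
begin

text \<open>Runs become derivations by reading the copies of \<open>E\<close> as fuel: each copy performs one machine
  step, the disjunction in a zero test forks off a branch that checks \<open>r = 0\<close> by being unable to
  end in \<open>D\<close> otherwise, and \<open>D\<close> accepts every configuration once the fuel is spent. For the converse,
  cut elimination is avoided by phase semantics: the sequent is interpreted in a commutative monoid
  of configurations with fuel, with the pole of all configurations that can make as many steps as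
  they have fuel. Then \<open>E\<close> contains one unit of fuel and \<open>D\<close> lies in the pole, so a derivation gives
  runs of every length, which by determinism excludes halting.

  For hardness, a partial recursive function is compiled to a structured program on many counters,
  which is simulated on three counters through prime factorizations. Applied to the search for a
  counterexample to a decidable predicate, only the outermost loop can diverge, so it suffices to
  simulate terminating executions.\<close>

section \<open>Runs yield derivations\<close>

text \<open>The delicate point is the zero test. A branch that has switched to \<open>z_r\<close>
  must still burn the remaining copies of \<open>E\<close>; the conjuncts
  \<open>z_r \<multimap> z_r\<close> exist for this, and in the model they force points with a
  zero-test token to stay in the pole for every amount of fuel. The join in
  \<open>q0 \<or> z_r\<close> becomes the double orthogonal of a union: a context has to accept both
  alternatives at once, and accepting \<open>z_r\<close> means that \<open>r\<close> is empty. Both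
  directions speak only of runs of every finite length, so no infinite run is ever constructed. Read
  upwards, the infinitary rule asks for one premise per amount of fuel; conversely, a cut with
  \<open>E^n \<turnstile> E^*\<close> recovers any prescribed length. For hardness the machine may
  depend on the predicate but not on its argument, so that \<open>E\<close> and \<open>D\<close> are
  fixed and only the number of copies of the first register varies. The argument therefore arrives
  in unary, and the machine itself must turn it into a prime-power code. Divergence is outside the
  big-step semantics and is handled separately for the single loop that can diverge.\<close>

lemma iterated_MeetL:
  assumes "A \<in> set As" "add_mset A \<Gamma> \<turnstile> C"
  shows "add_mset (iterated Meet As) \<Gamma> \<turnstile> C"
  using assms by (induction As) (auto intro: derivable.intros)

lemma iterated_JoinR:
  assumes "A \<in> set As" "\<Gamma> \<turnstile> A"
  shows "\<Gamma> \<turnstile> iterated Join As"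
  using assms by (induction As) (auto intro: derivable.intros)

lemma Star_replicate: "replicate_mset n A \<turnstile> Star A"
proof -
  have "sum_list (replicate n {#A#}) \<turnstile> Star A"
    by (rule derivable.StarR) (auto intro: derivable.Ax)
  moreover have "sum_list (replicate n {#A#}) = replicate_mset n A"
    by (induction n) auto
  ultimately show ?thesis by simp
qed

definition regs_mset :: "('q role \<Rightarrow> nat) \<Rightarrow> (reg \<Rightarrow> nat) \<Rightarrow> fm multiset" where
  "regs_mset v s = replicate_mset (s RegA) (reg_var v RegA) + replicate_mset (s RegB) (reg_var v RegB)
     + replicate_mset (s RegC) (reg_var v RegC)"

lemma regs_mset_inc: "regs_mset v (s(r := Suc (s r))) = add_mset (reg_var v r) (regs_mset v s)"
  by (cases r) (auto simp: regs_mset_def)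

lemma regs_mset_dec:
  assumes "s r > 0"
  shows "regs_mset v s = add_mset (reg_var v r) (regs_mset v (s(r := s r - 1)))"
proof -
  have "regs_mset v ((s(r := s r - 1))(r := Suc ((s(r := s r - 1)) r))) = regs_mset v s"
    using assms by (intro arg_cong[of _ _ "regs_mset v"]) auto
  then show ?thesis by (simp only: regs_mset_inc)
qed

lemma derivable_D_state:
  assumes "q \<in> set qs"
  shows "add_mset (state_var v q) (regs_mset v s) \<turnstile> D_fm v qs"
proof -
  have "{#state_var v q#} \<turnstile> iterated Join (map (state_var v) qs)"
    by (rule iterated_JoinR) (use assms in \<open>auto intro: derivable.Ax\<close>)
  then have "replicate_mset (s RegA) (reg_var v RegA) + (replicate_mset (s RegB) (reg_var v RegB)
     + (replicate_mset (s RegC) (reg_var v RegC) + {#state_var v q#})) \<turnstile>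
     Star (reg_var v RegA) \<odot> Star (reg_var v RegB) \<odot> Star (reg_var v RegC) \<odot> iterated Join (map (state_var v) qs)"
    by (intro derivable.FuseR Star_replicate)
  then show ?thesis
    unfolding D_fm_def Let_def by (intro derivable.JoinR1) (simp add: regs_mset_def add_ac)
qed

lemma derivable_D_ztest:
  assumes "s r = 0"
  shows "add_mset (ztest_var v r) (regs_mset v s) \<turnstile> D_fm v qs"
proof -
  have *: "replicate_mset (s i) (reg_var v i) + (replicate_mset (s j) (reg_var v j) + {#ztest_var v r#})
     \<turnstile> Star (reg_var v i) \<odot> Star (reg_var v j) \<odot> ztest_var v r" for i j
    by (intro derivable.FuseR Star_replicate derivable.Ax)
  show ?thesis
  proof (cases r)
    case RegA
    show ?thesis
      unfolding D_fm_def Let_def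
      by (rule derivable.JoinR2, rule derivable.JoinR1)
        (use *[of RegB RegC] assms RegA in \<open>simp add: regs_mset_def add_ac\<close>)
  next
    case RegB
    show ?thesis
      unfolding D_fm_def Let_def
      by (rule derivable.JoinR2, rule derivable.JoinR2, rule derivable.JoinR1)
        (use *[of RegA RegC] assms RegB in \<open>simp add: regs_mset_def add_ac\<close>)
  next
    case RegC
    show ?thesis
      unfolding D_fm_def Let_def
      by (rule derivable.JoinR2, rule derivable.JoinR2, rule derivable.JoinR2)
        (use *[of RegA RegB] assms RegC in \<open>simp add: regs_mset_def add_ac\<close>)
  qed
qed

text \<open>This is the purpose of the conjuncts \<open>idle_fm\<close>: each copy of
  \<open>E\<close> is spent on \<open>z_r \<multimap> z_r\<close>, which returns the zero-test
  token, until the disjunct of \<open>D\<close> without register \<open>r\<close> applies.\<close>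

lemma derivable_ztest:
  assumes "s r = 0"
  shows "replicate_mset n (E_fm v ins) + add_mset (ztest_var v r) (regs_mset v s) \<turnstile> D_fm v qs"
proof (induction n)
  case 0
  then show ?case using derivable_D_ztest[where s=s and r=r] assms by simp
next
  case (Suc n)
  let ?G = "replicate_mset n (E_fm v ins) + regs_mset v s"
  have "add_mset (idle_fm v r) (?G + {#ztest_var v r#}) \<turnstile> D_fm v qs"
    unfolding idle_fm_def by (rule derivable.ImpL) (use Suc in \<open>auto intro: derivable.Ax\<close>)
  then have "add_mset (E_fm v ins) (?G + {#ztest_var v r#}) \<turnstile> D_fm v qs"
    unfolding E_fm_def by (rule iterated_MeetL[rotated]) (cases r; simp)
  then show ?case by (simp add: add_mset_commute)
qed

lemma E_fmL:
  assumes "I \<in> set ins" "add_mset (instr_fm v I) \<Gamma> \<turnstile> C"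
  shows "add_mset (E_fm v ins) \<Gamma> \<turnstile> C"
  unfolding E_fm_def using assms by (intro iterated_MeetL[of "instr_fm v I"]) auto

lemma derivable_step:
  assumes ins: "set ins = instrs M" and step: "step M (p, s) (q, t)"
    and der: "replicate_mset n (E_fm v ins) + add_mset (state_var v q) (regs_mset v t) \<turnstile> D_fm v qs"
  shows "replicate_mset (Suc n) (E_fm v ins) + add_mset (state_var v p) (regs_mset v s) \<turnstile> D_fm v qs"
  using step
proof cases
  case (1 r)
  let ?G = "replicate_mset n (E_fm v ins) + regs_mset v s"
  have "add_mset (state_var v p \<multimap> (state_var v q \<odot> reg_var v r)) (?G + {#state_var v p#}) \<turnstile> D_fm v qs"
    by (intro derivable.ImpL derivable.Ax derivable.FuseL)
      (use der 1 in \<open>simp add: regs_mset_inc add_mset_commute\<close>)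
  then have "add_mset (E_fm v ins) (?G + {#state_var v p#}) \<turnstile> D_fm v qs"
    using 1 ins by (intro E_fmL[where I = "INC p r q"]) auto
  then show ?thesis by (simp add: add_mset_commute)
next
  case (2 r q1)
  let ?G = "replicate_mset n (E_fm v ins) + regs_mset v s"
  \<comment> \<open>The join leaves two premises: the next configuration, given by
    \<open>der\<close>, and the side branch with the zero-test token, which closes because
    \<open>s r = 0\<close>.\<close>
  have "add_mset (state_var v p \<multimap> (state_var v q \<^bold>\<or> ztest_var v r)) (?G + {#state_var v p#}) \<turnstile> D_fm v qs"
    by (intro derivable.ImpL derivable.Ax derivable.JoinL)
      (use der 2 derivable_ztest[of s r n v ins qs] in \<open>simp_all\<close>)
  then have "add_mset (instr_fm v (JZDEC p r q q1)) (?G + {#state_var v p#}) \<turnstile> D_fm v qs"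
    by (auto intro: derivable.MeetL2)
  then have "add_mset (E_fm v ins) (?G + {#state_var v p#}) \<turnstile> D_fm v qs"
    using 2 ins by (intro E_fmL[where I = "JZDEC p r q q1"]) auto
  then show ?thesis by (simp add: add_mset_commute)
next
  case (3 r q0)
  let ?G = "replicate_mset n (E_fm v ins) + regs_mset v t"
  have "{#state_var v p#} + {#reg_var v r#} \<turnstile> state_var v p \<odot> reg_var v r"
    by (intro derivable.intros)
  then have "add_mset ((state_var v p \<odot> reg_var v r) \<multimap> state_var v q)
      (?G + ({#state_var v p#} + {#reg_var v r#})) \<turnstile> D_fm v qs"
    by (rule derivable.ImpL) (use der in simp)
  then have "add_mset (instr_fm v (JZDEC p r q0 q)) (?G + ({#state_var v p#} + {#reg_var v r#})) \<turnstile> D_fm v qs"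
    by (auto intro: derivable.MeetL1)
  then have "add_mset (E_fm v ins) (?G + ({#state_var v p#} + {#reg_var v r#})) \<turnstile> D_fm v qs"
    using 3 ins by (intro E_fmL[where I = "JZDEC p r q0 q"]) auto
  then show ?thesis
    using 3 regs_mset_dec[of s r v] by (simp add: add_mset_commute)
qed

lemma step_states:
  assumes "det_machine M" "step M (p, s) (q, t)"
  shows "q \<in> states M"
  using assms(2) by cases (use assms(1) in \<open>force simp: det_machine_def\<close>)+

lemma step_exists:
  assumes "det_machine M" "p \<in> states M" "p \<noteq> final M"
  shows "\<exists>q t. step M (p, s) (q, t)"
proof -
  from assms obtain I where I: "I \<in> instrs M" "p = instr_source I"
    unfolding det_machine_def by blast
  show ?thesis
  proof (cases I)
    case (INC p' r q)
    then show ?thesis using I step.intros(1) by fastforce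
  next
    case (JZDEC p' r q0 q1)
    then show ?thesis using I step.intros(2,3)[of p r q0 q1 M s] by (cases "s r = 0") auto
  qed
qed

text \<open>Induction on the fuel with the configuration arbitrary, since never reaching
  \<open>final M\<close> is inherited by the successor and guarantees that there is one.\<close>

lemma derivable_if_never_final:
  assumes M: "det_machine M" and ins: "set ins = instrs M" and qs: "set qs = states M"
  assumes "q \<in> states M" "\<And>t. \<not> (step M)\<^sup>*\<^sup>* (q, s) (final M, t)"
  shows "replicate_mset n (E_fm v ins) + add_mset (state_var v q) (regs_mset v s) \<turnstile> D_fm v qs"
  using assms(4,5)
proof (induction n arbitrary: q s)
  case 0
  then show ?case using derivable_D_state[of q qs v s] qs by simp
next
  case (Suc n)
  from Suc.prems(2) have "q \<noteq> final M" by blast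
  then obtain q' s' where *: "step M (q, s) (q', s')"
    using step_exists[OF M Suc.prems(1)] by blast
  show ?case
  proof (rule derivable_step[OF ins *], rule Suc.IH)
    show "q' \<in> states M" using step_states[OF M *] .
    show "\<not> (step M)\<^sup>*\<^sup>* (q', s') (final M, t)" for t
      using Suc.prems(2)[of t] * by (auto intro: converse_rtranclp_into_rtranclp)
  qed
qed

lemma regs_mset_initial: "regs_mset v ((\<lambda>r. 0)(RegA := x)) = replicate_mset x (reg_var v RegA)"
  by (simp add: regs_mset_def)

lemma derivable_if_runs_forever:
  assumes M: "det_machine M" and ins: "set ins = instrs M" and qs: "set qs = states M"
    and run: "runs_forever M x"
  shows "{#Star (E_fm v ins), state_var v (init M)#} + replicate_mset x (reg_var v RegA) \<turnstile> D_fm v qs"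
proof -
  let ?s = "(\<lambda>r. 0)(RegA := x)"
  have "add_mset (Star (E_fm v ins)) (add_mset (state_var v (init M)) (regs_mset v ?s)) \<turnstile> D_fm v qs"
  proof (rule derivable.StarL)
    fix n
    have "replicate_mset n (E_fm v ins) + add_mset (state_var v (init M)) (regs_mset v ?s) \<turnstile> D_fm v qs"
      using run M by (intro derivable_if_never_final[OF M ins qs])
        (auto simp: runs_forever_def halts_def initial_config_def det_machine_def)
    then show "add_mset (state_var v (init M)) (regs_mset v ?s) + replicate_mset n (E_fm v ins) \<turnstile> D_fm v qs"
      by (simp add: add.commute)
  qed
  then show ?thesis by (simp only: regs_mset_initial) simp
qed

section \<open>Phase semantics\<close>

definition orth :: "'m::comm_monoid_add set \<Rightarrow> 'm set \<Rightarrow> 'm set" where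
  "orth P X = {y. \<forall>x\<in>X. x + y \<in> P}"

abbreviation closure :: "'m::comm_monoid_add set \<Rightarrow> 'm set \<Rightarrow> 'm set" where
  "closure P X \<equiv> orth P (orth P X)"

definition closed :: "'m::comm_monoid_add set \<Rightarrow> 'm set \<Rightarrow> bool" where
  "closed P X \<longleftrightarrow> closure P X \<subseteq> X"

lemma closure_superset: "X \<subseteq> closure P X"
  by (auto simp: orth_def add.commute)

lemma closed_orth: "closed P (orth P X)"
  unfolding closed_def
proof
  fix y assume y: "y \<in> closure P (orth P X)"
  have "x + y \<in> P" if "x \<in> X" for x
  proof -
    have "x \<in> closure P X" using that closure_superset by blast
    then show ?thesis using y unfolding orth_def by blast
  qed
  then show "y \<in> orth P X" by (simp add: orth_def)
qed

lemma closure_subset_iff: "closed P Z \<Longrightarrow> closure P X \<subseteq> Z \<longleftrightarrow> X \<subseteq> Z"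
  using closure_superset[of X P] unfolding closed_def by (auto simp: orth_def subset_iff)

lemma closure_subset: "closed P Z \<Longrightarrow> X \<subseteq> Z \<Longrightarrow> closure P X \<subseteq> Z"
  by (simp add: closure_subset_iff)

text \<open>The pole is the orthogonal of the neutral element.\<close>

lemma closed_pole: "closed P P"
  using closed_orth[of P "{0}"] by (simp add: orth_def)

lemma closed_Int: "closed P X \<Longrightarrow> closed P Y \<Longrightarrow> closed P (X \<inter> Y)"
  unfolding closed_def orth_def by blast

definition residual :: "'m::comm_monoid_add set \<Rightarrow> 'm set \<Rightarrow> 'm set" where
  "residual X Y = {z. \<forall>x\<in>X. z + x \<in> Y}"

lemma residual_iff: "Z \<subseteq> residual X Y \<longleftrightarrow> Z + X \<subseteq> Y"
  by (auto simp: residual_def set_plus_def)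

text \<open>Writing \<open>Y\<close> as a double orthogonal turns the residual into the orthogonal
  of \<open>X + orth P Y\<close>.\<close>

lemma closed_residual:
  assumes "closed P Y"
  shows "closed P (residual X Y)"
proof -
  have "Y = orth P (orth P Y)"
    using assms closure_superset[of Y P] by (auto simp: closed_def)
  then have "residual X Y = {z. \<forall>x\<in>X. \<forall>y\<in>orth P Y. y + (z + x) \<in> P}"
    unfolding residual_def orth_def by auto
  also have "\<dots> = orth P (X + orth P Y)"
    unfolding orth_def set_plus_def by (auto simp: add_ac)
  finally show ?thesis using closed_orth by simp
qed

text \<open>Residuation moves \<open>Y\<close> to the right, where the residual is again closed; so
  closures may be dropped inside an antecedent. The left rules of all formulae interpreted by a
  closure rest on this.\<close>

lemma closure_plus_subset_iff:
  assumes "closed P Z"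
  shows "closure P X + Y \<subseteq> Z \<longleftrightarrow> X + Y \<subseteq> Z"
  using closure_subset_iff[OF closed_residual[OF assms, of Y]] by (simp add: residual_iff)

lemma closure_plus_closure_subset_iff:
  assumes "closed P Z"
  shows "closure P X + closure P Y + W \<subseteq> Z \<longleftrightarrow> X + Y + W \<subseteq> Z"
  using closure_plus_subset_iff[OF assms, of X "closure P Y + W"]
    closure_plus_subset_iff[OF assms, of Y "X + W"]
  by (simp add: add_ac)

text \<open>Phase semantics with the monoid written additively. \<open>Imp\<close> and
  \<open>Meet\<close> preserve closed sets and get no closure. The \<open>Star\<close> clause
  collects all n-fold pointwise sums, matching the infinitary left rule.\<close>

primrec interp :: "'m::comm_monoid_add set \<Rightarrow> (nat \<Rightarrow> 'm) \<Rightarrow> fm \<Rightarrow> 'm set" where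
  "interp P a (Var n) = closure P {a n}"
| "interp P a Zero = closure P {}"
| "interp P a One = closure P {0}"
| "interp P a (A \<multimap> B) = residual (interp P a A) (interp P a B)"
| "interp P a (A \<odot> B) = closure P (interp P a A + interp P a B)"
| "interp P a (A \<^bold>\<or> B) = closure P (interp P a A \<union> interp P a B)"
| "interp P a (A \<^bold>\<and> B) = interp P a A \<inter> interp P a B"
| "interp P a (Star A) = closure P (\<Union>n. \<Sum>X\<in>#replicate_mset n (interp P a A). X)"

lemma closed_interp: "closed P (interp P a A)"
  by (induction A) (auto intro: closed_orth closed_residual closed_Int)

definition ant :: "'m::comm_monoid_add set \<Rightarrow> (nat \<Rightarrow> 'm) \<Rightarrow> fm multiset \<Rightarrow> 'm set" where
  "ant P a \<Gamma> = (\<Sum>A\<in>#\<Gamma>. interp P a A)"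

lemma ant_simps [simp]:
  "ant P a {#} = {0}"
  "ant P a (add_mset A \<Gamma>) = interp P a A + ant P a \<Gamma>"
  "ant P a (\<Gamma> + \<Delta>) = ant P a \<Gamma> + ant P a \<Delta>"
  by (auto simp: ant_def set_zero)

lemma set_plus_UN: "(\<Union>i\<in>I. X i) + Y = (\<Union>i\<in>I. X i + Y)" for Y :: "'m::comm_monoid_add set"
  by (auto simp: set_plus_def)

lemma set_plus_Un: "(X \<union> X') + Y = (X + Y) \<union> (X' + Y)" for Y :: "'m::comm_monoid_add set"
  by (auto simp: set_plus_def)

text \<open>Pointwise sums are monotone and distribute over arbitrary unions: the first makes
  \<open>Cut\<close> a matter of transitivity of inclusion, the second settles
  \<open>StarL\<close>.\<close>

theorem interp_sound:
  assumes "\<Gamma> \<turnstile> C"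
  shows "ant P a \<Gamma> \<subseteq> interp P a C"
  using assms
proof induction
  case (Ax A)
  then show ?case by simp
next
  case (ZeroL \<Gamma> C)
  then show ?case
    by (simp add: closure_plus_subset_iff[OF closed_interp])
next
  case OneR
  then show ?case by (simp add: closure_superset)
next
  case (OneL \<Gamma> C)
  then show ?case
    by (simp add: closure_plus_subset_iff[OF closed_interp])
next
  case (ImpL \<Pi> A B \<Gamma> C)
  have "residual (interp P a A) (interp P a B) + interp P a A \<subseteq> interp P a B"
    by (simp flip: residual_iff)
  then have "(residual (interp P a A) (interp P a B) + ant P a \<Pi>) + ant P a \<Gamma> \<subseteq> interp P a B + ant P a \<Gamma>"
    using ImpL.IH(1) by (meson order_refl order_trans set_plus_mono2)
  then show ?case using ImpL.IH(2) by (simp add: add_ac)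
next
  case (ImpR A \<Pi> B)
  then show ?case by (simp add: residual_iff add.commute)
next
  case (FuseL A B \<Gamma> C)
  then show ?case by (simp add: closure_plus_subset_iff[OF closed_interp] flip: add.assoc)
next
  case (FuseR \<Pi> A \<Delta> B)
  from FuseR.IH have "ant P a \<Pi> + ant P a \<Delta> \<subseteq> interp P a A + interp P a B" by (rule set_plus_mono2)
  then show ?case unfolding ant_simps interp.simps by (rule order_trans[OF _ closure_superset])
next
  case (JoinL A \<Gamma> C B)
  show ?case
    using JoinL.IH unfolding ant_simps interp.simps closure_plus_subset_iff[OF closed_interp] set_plus_Un
    by (rule Un_least)
next
  case (JoinR1 \<Pi> A B)
  show ?case unfolding interp.simps by (rule order_trans[OF le_supI1[OF JoinR1.IH] closure_superset])
next
  case (JoinR2 \<Pi> B A)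
  show ?case unfolding interp.simps by (rule order_trans[OF le_supI2[OF JoinR2.IH] closure_superset])
next
  case (MeetL1 A \<Gamma> C B)
  then show ?case by (auto simp: set_plus_def)
next
  case (MeetL2 B \<Gamma> C A)
  then show ?case by (auto simp: set_plus_def)
next
  case (MeetR \<Pi> A B)
  then show ?case by simp
next
  case (StarL \<Gamma> A C)
  then have "(\<Sum>X\<in>#replicate_mset n (interp P a A). X) + ant P a \<Gamma> \<subseteq> interp P a C" for n
    by (simp add: ant_def image_replicate_mset add.commute)
  then show ?case
    unfolding ant_simps interp.simps closure_plus_subset_iff[OF closed_interp] set_plus_UN by (rule UN_least)
next
  case (StarR \<Pi>s A)
  then have "ant P a (sum_list \<Pi>s) \<subseteq> (\<Sum>X\<in>#replicate_mset (length \<Pi>s) (interp P a A). X)"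
  proof (induction \<Pi>s)
    case Nil
    then show ?case by (simp add: set_zero)
  next
    case (Cons \<Pi> \<Pi>s)
    then show ?case by (simp add: set_plus_mono2)
  qed
  then show ?case unfolding interp.simps by (intro order_trans[OF _ closure_superset]) blast
next
  case (Cut \<Pi> A \<Gamma> C)
  have "ant P a \<Pi> + ant P a \<Gamma> \<subseteq> interp P a A + ant P a \<Gamma>"
    using Cut.IH(1) by (simp add: set_plus_mono2)
  then show ?case using Cut.IH(2) by (simp add: add.commute)
qed

lemma interp_iterated_Meet:
  "As \<noteq> [] \<Longrightarrow> interp P a (iterated Meet As) = (\<Inter>A\<in>set As. interp P a A)"
  by (induction As) auto

lemma interp_iterated_Join_subset:
  assumes "closed P Z" "As \<noteq> []" "\<And>A. A \<in> set As \<Longrightarrow> interp P a A \<subseteq> Z"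
  shows "interp P a (iterated Join As) \<subseteq> Z"
  using assms(2,3) by (induction As) (auto simp: closure_subset_iff[OF assms(1)])

text \<open>Next to the closed set \<open>Z\<close> both closures, around the generator and around
  the union, drop out; induction on the number of summands remains.\<close>

lemma interp_Star_plus_subset:
  assumes "closed P Z" and "\<And>z. z \<in> Z \<Longrightarrow> a n + z \<in> Z"
  shows "interp P a (Star (Var n)) + Z \<subseteq> Z"
proof -
  have 1: "closure P {a n} + Z \<subseteq> Z"
    unfolding closure_plus_subset_iff[OF assms(1)] using assms(2) by (auto simp: set_plus_def)
  have "(\<Sum>X\<in>#replicate_mset k (closure P {a n}). X) + Z \<subseteq> Z" for k
  proof (induction k)
    case 0
    then show ?case by simp
  next
    case (Suc k)
    have "closure P {a n} + ((\<Sum>X\<in>#replicate_mset k (closure P {a n}). X) + Z) \<subseteq> closure P {a n} + Z"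
      using Suc by (simp add: set_plus_mono2)
    then show ?case using 1 by (simp add: add.assoc)
  qed
  then show ?thesis
    by (simp add: closure_plus_subset_iff[OF assms(1)] set_plus_UN UN_subset_iff)
qed

section \<open>Derivations yield runs\<close>

text \<open>The points of the model count the available copies of \<open>E\<close>, the registers, and collect the
  remaining control tokens (states or zero-test variables). A point lies in the pole if the
  configuration it describes can make as many steps as there are copies of \<open>E\<close>.\<close>

type_synonym 'q point = "nat \<times> (reg \<Rightarrow> nat) \<times> ('q + reg) multiset"

text \<open>The fuel \<open>n\<close> is ignored beside a zero-test token, because
  \<open>z_r \<multimap> z_r\<close> has to contain one unit of fuel. Demanding exactly one control
  token keeps contexts from bringing in another.\<close>

definition pole :: "'q machine \<Rightarrow> 'q point set" where
  "pole M = {(n, s, {#Inl q#}) | n s q. \<exists>c. (step M ^^ n) (q, s) c}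
     \<union> {(n, s, {#Inr r#}) | n s r. s r = 0}"

fun role_point :: "'q role \<Rightarrow> 'q point" where
  "role_point (State q) = (0, 0, {#Inl q#})"
| "role_point (Reg r) = (0, (\<lambda>i. if i = r then 1 else 0), {#})"
| "role_point (ZTest r) = (0, 0, {#Inr r#})"

text \<open>Names are decoded by inverting \<open>v\<close> on the roles in use, where
  \<open>distinct_vars\<close> makes it injective; any other name receives an unspecified
  point.\<close>

definition var_point :: "'q machine \<Rightarrow> ('q role \<Rightarrow> nat) \<Rightarrow> nat \<Rightarrow> 'q point" where
  "var_point M v n = role_point (inv_into (State ` states M \<union> range Reg \<union> range ZTest) v n)"

abbreviation machine_interp :: "'q machine \<Rightarrow> ('q role \<Rightarrow> nat) \<Rightarrow> fm \<Rightarrow> 'q point set" where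
  "machine_interp M v \<equiv> interp (pole M) (var_point M v)"

lemma var_point:
  assumes "distinct_vars M v" "\<rho> \<in> State ` states M \<union> range Reg \<union> range ZTest"
  shows "var_point M v (v \<rho>) = role_point \<rho>"
  using assms by (simp add: var_point_def distinct_vars_def inv_into_f_f)

lemma var_point_simps:
  assumes "distinct_vars M v"
  shows "q \<in> states M \<Longrightarrow> var_point M v (v (State q)) = (0, 0, {#Inl q#})"
    and "var_point M v (v (Reg r)) = (0, (\<lambda>i. if i = r then 1 else 0), {#})"
    and "var_point M v (v (ZTest r)) = (0, 0, {#Inr r#})"
  using var_point[OF assms] by auto

lemma inc_fun_upd: "(\<lambda>i. if i = r then 1 else 0) + s = (s(r := Suc (s r)) :: reg \<Rightarrow> nat)"
  by (auto simp: plus_fun_def)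

lemma closureI: "(\<And>w. (\<forall>x\<in>X. x + w \<in> P) \<Longrightarrow> w + y \<in> P) \<Longrightarrow> y \<in> closure P X"
  by (auto simp: orth_def)

lemma singleton_interp_Imp:
  "{e} \<subseteq> interp P a (A \<multimap> B) \<longleftrightarrow> interp P a A + {e} \<subseteq> interp P a B"
  using residual_iff[of "{e}" "interp P a A" "interp P a B"] by (simp add: add.commute)

lemma singleton_plus: "{x} + {y} = {x + y}" for x :: "'m::comm_monoid_add"
  by (simp add: set_plus_def)

lemma pole_simps:
  "(n, s, {#Inl q#}) \<in> pole M \<longleftrightarrow> (\<exists>c. (step M ^^ n) (q, s) c)"
  "(n, s, {#Inr r#}) \<in> pole M \<longleftrightarrow> s r = 0"
  by (auto simp: pole_def)

lemma pole_Inl_add: "(n, s, add_mset (Inl q) K) \<in> pole M \<longleftrightarrow> K = {#} \<and> (\<exists>c. (step M ^^ n) (q, s) c)"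
  by (auto simp: pole_def)

lemma pole_Inr_add: "(n, s, add_mset (Inr r) K) \<in> pole M \<longleftrightarrow> K = {#} \<and> s r = 0"
  by (auto simp: pole_def)

lemma pole_step: "step M (p, s) (q, t) \<Longrightarrow> (n, t, {#Inl q#}) \<in> pole M \<Longrightarrow> (Suc n, s, {#Inl p#}) \<in> pole M"
  unfolding pole_simps by (metis relpowp_Suc_I2)

text \<open>Whether a point with a zero-test token lies in the pole does not depend on its fuel, so
  one more unit is harmless.\<close>

lemma E_point_idle:
  assumes "distinct_vars M v"
  shows "(1, 0, {#}) \<in> machine_interp M v (idle_fm v r)"
proof -
  have "(1, 0, {#Inr r#}) \<in> closure (pole M) {(0, 0, {#Inr r#})}"
    by (rule closureI) (auto simp: pole_Inr_add)
  then have "{(1, 0, {#})} \<subseteq> machine_interp M v (idle_fm v r)"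
    unfolding idle_fm_def singleton_interp_Imp
    by (simp add: var_point_simps[OF assms] closure_plus_subset_iff[OF closed_orth] singleton_plus)
  then show ?thesis by simp
qed

text \<open>Closure membership is tested on contexts \<open>w\<close>: if \<open>w\<close> together
  with the target of the instruction can run \<open>n\<close> steps, then \<open>w\<close> together
  with its source and one more unit of fuel can run \<open>Suc n\<close>.\<close>

lemma E_point_instr:
  assumes v: "distinct_vars M v" and I: "I \<in> instrs M" "instr_states I \<subseteq> states M"
  shows "(1, 0, {#}) \<in> machine_interp M v (instr_fm v I)"
proof (cases I)
  case (INC p r q)
  have "(1, 0, {#Inl p#}) \<in> closure (pole M) {(0, (\<lambda>i. if i = r then 1 else 0), {#Inl q#})}"
  proof (rule closureI)
    fix w :: "'a point"
    assume *: "\<forall>x\<in>{(0, (\<lambda>i. if i = r then 1 else 0), {#Inl q#})}. x + w \<in> pole M"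
    obtain n s K where w: "w = (n, s, K)" by (cases w)
    \<comment> \<open>\<open>Inl q\<close> is already the single control token allowed in the pole,
      so the context supplies only fuel and registers.\<close>
    have "K = {#}" "(n, s(r := Suc (s r)), {#Inl q#}) \<in> pole M"
      using * by (auto simp: w inc_fun_upd pole_Inl_add)
    then show "w + (1, 0, {#Inl p#}) \<in> pole M"
      using pole_step[of M p s q "s(r := Suc (s r))" n] step.intros(1)[of p r q M s] I INC
      by (simp add: w)
  qed
  moreover have "closure (pole M) {(0, (\<lambda>i. if i = r then 1 else 0), {#Inl q#})}
      \<subseteq> machine_interp M v (state_var v q \<odot> reg_var v r)"
    unfolding closure_subset_iff[OF closed_interp]
  proof -
    have "var_point M v (v (State q)) + var_point M v (v (Reg r)) \<in>
       machine_interp M v (state_var v q) + machine_interp M v (reg_var v r)"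
      by (intro set_plus_intro) (use closure_superset in auto)
    also have "\<dots> \<subseteq> machine_interp M v (state_var v q \<odot> reg_var v r)"
      by (simp only: interp.simps(5) closure_superset)
    finally show "{(0, (\<lambda>i. if i = r then 1 else 0), {#Inl q#})} \<subseteq> machine_interp M v (state_var v q \<odot> reg_var v r)"
      using I INC by (simp add: var_point_simps[OF v] del: interp.simps)
  qed
  ultimately have "{(1, 0, {#Inl p#})} \<subseteq> machine_interp M v (state_var v q \<odot> reg_var v r)"
    by blast
  then have "{(1, 0, {#})} \<subseteq> machine_interp M v (state_var v p \<multimap> (state_var v q \<odot> reg_var v r))"
    unfolding singleton_interp_Imp using I INC
    by (simp add: var_point_simps[OF v] singleton_plus closure_plus_subset_iff[OF closed_orth])
  then show ?thesis using INC by simp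
next
  case (JZDEC p r q0 q1)
  have "(1, (\<lambda>i. if i = r then 1 else 0), {#Inl p#}) \<in> closure (pole M) {(0, 0, {#Inl q1#})}"
  proof (rule closureI)
    fix w :: "'a point"
    assume *: "\<forall>x\<in>{(0, 0, {#Inl q1#})}. x + w \<in> pole M"
    obtain n s K where w: "w = (n, s, K)" by (cases w)
    have "K = {#}" "(n, s, {#Inl q1#}) \<in> pole M"
      using * by (auto simp: w pole_Inl_add)
    then show "w + (1, (\<lambda>i. if i = r then 1 else 0), {#Inl p#}) \<in> pole M"
      using pole_step[of M p "s(r := Suc (s r))" q1 s n] step.intros(3)[of p r q0 q1 M "s(r := Suc (s r))"] I JZDEC
      by (simp add: w add.commute[of s] inc_fun_upd)
  qed
  then have dec: "{(1, 0, {#})} \<subseteq> machine_interp M v (state_var v p \<odot> reg_var v r \<multimap> state_var v q1)"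
    unfolding singleton_interp_Imp using I JZDEC
    by (simp add: var_point_simps[OF v] singleton_plus closure_plus_subset_iff[OF closed_orth]
        closure_plus_closure_subset_iff[OF closed_orth])
  \<comment> \<open>The context must accept both tokens of the union. Accepting \<open>Inr r\<close>
    yields \<open>s r = 0\<close>, which is what licenses the zero branch of the
    instruction.\<close>
  have "(1, 0, {#Inl p#}) \<in> closure (pole M) {(0, 0, {#Inl q0#}), (0, 0, {#Inr r#})}"
  proof (rule closureI)
    fix w :: "'a point"
    assume *: "\<forall>x\<in>{(0, 0, {#Inl q0#}), (0, 0, {#Inr r#})}. x + w \<in> pole M"
    obtain n s K where w: "w = (n, s, K)" by (cases w)
    have "K = {#}" "(n, s, {#Inl q0#}) \<in> pole M" "s r = 0"
      using * by (auto simp: w pole_Inl_add pole_Inr_add)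
    then show "w + (1, 0, {#Inl p#}) \<in> pole M"
      using pole_step[of M p s q0 s n] step.intros(2)[of p r q0 q1 M s] I JZDEC
      by (simp add: w)
  qed
  moreover have "closure (pole M) {(0, 0, {#Inl q0#}), (0, 0, {#Inr r#})}
      \<subseteq> machine_interp M v (state_var v q0 \<^bold>\<or> ztest_var v r)"
    unfolding closure_subset_iff[OF closed_interp]
  proof -
    have "{(0, 0, {#Inl q0#}), (0, 0, {#Inr r#})}
        \<subseteq> machine_interp M v (state_var v q0) \<union> machine_interp M v (ztest_var v r)"
      using I JZDEC closure_superset[of "{(0, 0, {#Inl q0#})}" "pole M"]
        closure_superset[of "{(0, 0, {#Inr r#})}" "pole M"]
      by (simp add: var_point_simps[OF v])
    also have "\<dots> \<subseteq> machine_interp M v (state_var v q0 \<^bold>\<or> ztest_var v r)"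
      by (simp only: interp.simps(6) closure_superset)
    finally show "{(0, 0, {#Inl q0#}), (0, 0, {#Inr r#})}
        \<subseteq> machine_interp M v (state_var v q0 \<^bold>\<or> ztest_var v r)" .
  qed
  ultimately have "{(1, 0, {#Inl p#})} \<subseteq> machine_interp M v (state_var v q0 \<^bold>\<or> ztest_var v r)"
    by blast
  then have "{(1, 0, {#})} \<subseteq> machine_interp M v (state_var v p \<multimap> (state_var v q0 \<^bold>\<or> ztest_var v r))"
    unfolding singleton_interp_Imp using I JZDEC
    by (simp add: var_point_simps[OF v] singleton_plus closure_plus_subset_iff[OF closed_orth])
  then show ?thesis using JZDEC dec by simp
qed

lemma E_point:
  assumes "det_machine M" "distinct_vars M v" "set ins = instrs M"
  shows "(1, 0, {#}) \<in> machine_interp M v (E_fm v ins)"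
proof -
  have "instr_states I \<subseteq> states M" if "I \<in> instrs M" for I
    using assms(1) that by (auto simp: det_machine_def)
  then show ?thesis
    using assms E_point_idle[OF assms(2)] E_point_instr[OF assms(2)]
    unfolding E_fm_def by (subst interp_iterated_Meet) auto
qed

text \<open>The orthogonal consists of the points that land in the pole beside every store in
  \<open>S\<close>. A unit of \<open>r\<close> can be shifted from the point to that store, and
  \<open>S\<close> absorbs it.\<close>

lemma Star_reg_plus_subset:
  assumes v: "distinct_vars M v" and "X \<subseteq> orth (pole M) {(0, s, {#}) | s. s \<in> S}"
    and S: "\<And>s. s \<in> S \<Longrightarrow> s(r := Suc (s r)) \<in> S"
  shows "machine_interp M v (Star (reg_var v r)) + X \<subseteq> orth (pole M) {(0, s, {#}) | s. s \<in> S}"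
proof -
  let ?Z = "orth (pole M) {(0, s, {#}) | s. s \<in> S}"
  have "machine_interp M v (Star (reg_var v r)) + ?Z \<subseteq> ?Z"
  proof (rule interp_Star_plus_subset[OF closed_orth])
    fix z assume z: "z \<in> ?Z"
    have "(0, s, {#}) + (var_point M v (v (Reg r)) + z) \<in> pole M" if "s \<in> S" for s
    proof -
      have "(0, s, {#}) + var_point M v (v (Reg r)) = (0, s(r := Suc (s r)), {#})"
        by (simp add: var_point_simps[OF v] add.commute[of s] inc_fun_upd)
      moreover have "(0, s(r := Suc (s r)), {#}) + z \<in> pole M"
        using z S[OF that] unfolding orth_def by blast
      ultimately show ?thesis by (simp flip: add.assoc)
    qed
    then show "var_point M v (v (Reg r)) + z \<in> ?Z"
      unfolding orth_def by blast
  qed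
  then show ?thesis
    using assms(2) by (meson order_refl order_trans set_plus_mono2)
qed

text \<open>The pole itself need not be stable under adding registers, as an extra unit can change a
  run that still has fuel. Each disjunct is therefore placed in a smaller set, the orthogonal of a
  set \<open>S\<close> of stores: all stores for a state, where a run of length 0 always exists, and
  those with \<open>r\<close> empty for \<open>z_r\<close>, which incrementing the other registers
  preserves. Since \<open>0 \<in> S\<close>, it lies in the pole.\<close>

lemma interp_D_subset:
  assumes v: "distinct_vars M v" and qs: "set qs = states M" "qs \<noteq> []"
  shows "machine_interp M v (D_fm v qs) \<subseteq> pole M"
proof -
  have orth_sub: "orth (pole M) {(0, s, {#}) | s. s \<in> S} \<subseteq> pole M" if "0 \<in> S" for S
    using that by (force simp: orth_def zero_prod_def[symmetric])
  let ?Z = "orth (pole M) {(0, s, {#}) | s. s \<in> UNIV}"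
  have "machine_interp M v (iterated Join (map (state_var v) qs)) \<subseteq> ?Z"
  proof (rule interp_iterated_Join_subset[OF closed_orth])
    fix A assume "A \<in> set (map (state_var v) qs)"
    then obtain q where q: "q \<in> states M" "A = state_var v q" using qs by auto
    then show "machine_interp M v A \<subseteq> ?Z"
      by (auto simp: var_point_simps[OF v] closure_subset_iff[OF closed_orth])
        (auto simp: orth_def pole_simps)
  qed (use qs in auto)
  then have 1: "machine_interp M v (Star (reg_var v RegA) \<odot> Star (reg_var v RegB) \<odot>
      Star (reg_var v RegC) \<odot> iterated Join (map (state_var v) qs)) \<subseteq> ?Z"
    unfolding interp.simps(5)
    by (intro closure_subset Star_reg_plus_subset[OF v] closed_orth) auto
  have 2: "machine_interp M v (Star (reg_var v i) \<odot> Star (reg_var v j) \<odot> ztest_var v r)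
      \<subseteq> orth (pole M) {(0, s, {#}) | s. s \<in> {s. s r = 0}}" if "i \<noteq> r" "j \<noteq> r" for i j r
  proof -
    have "machine_interp M v (ztest_var v r) \<subseteq> orth (pole M) {(0, s, {#}) | s. s \<in> {s. s r = 0}}"
      by (auto simp: var_point_simps[OF v] closure_subset_iff[OF closed_orth])
        (auto simp: orth_def pole_simps)
    then show ?thesis
      unfolding interp.simps(5)
      by (intro closure_subset Star_reg_plus_subset[OF v] closed_orth) (use that in auto)
  qed
  show ?thesis
    unfolding D_fm_def Let_def interp.simps(6)
    by (rule closure_subset[OF closed_pole Un_least[OF order_trans[OF 1 orth_sub]
          closure_subset[OF closed_pole Un_least[OF order_trans[OF 2 orth_sub]
            closure_subset[OF closed_pole Un_least[OF order_trans[OF 2 orth_sub] order_trans[OF 2 orth_sub]]]]]]])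
      simp_all
qed

lemma ant_replicate_mem:
  assumes "e \<in> interp P a A" "x \<in> ant P a \<Gamma>"
  shows "((+) e ^^ n) x \<in> ant P a (replicate_mset n A + \<Gamma>)"
proof (induction n)
  case (Suc n)
  then show ?case using set_plus_intro[OF assms(1) Suc] by simp
qed (use assms in simp)

lemma long_run_if_derivable:
  assumes M: "det_machine M" and v: "distinct_vars M v" and ins: "set ins = instrs M"
    and qs: "set qs = states M"
    and der: "{#Star (E_fm v ins), state_var v (init M)#} + replicate_mset x (reg_var v RegA) \<turnstile> D_fm v qs"
  shows "\<exists>c. (step M ^^ n) (initial_config M x) c"
proof -
  have init: "init M \<in> states M" using M by (auto simp: det_machine_def)
  \<comment> \<open>Cutting with \<open>Star_replicate\<close> trades the starred formula for
    \<open>n\<close> copies of \<open>E\<close>, so the point built below carries exactly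
    \<open>n\<close> units of fuel.\<close>
  have "{#state_var v (init M)#} + replicate_mset x (reg_var v RegA) + replicate_mset n (E_fm v ins) \<turnstile> D_fm v qs"
    by (rule derivable.Cut[OF Star_replicate]) (use der in simp)
  then have "ant (pole M) (var_point M v)
      (replicate_mset n (E_fm v ins) + (replicate_mset x (reg_var v RegA) + {#state_var v (init M)#})) \<subseteq> pole M"
    using interp_sound[where P = "pole M" and a = "var_point M v"] interp_D_subset[OF v qs] init qs
    by (force simp: add_ac)
  have "var_point M v (v (State (init M))) \<in> ant (pole M) (var_point M v) {#state_var v (init M)#}"
    using closure_superset by auto
  then have "((+) (1, 0, {#}) ^^ n) (((+) (var_point M v (v (Reg RegA))) ^^ x)
      (var_point M v (v (State (init M))))) \<in> pole M"
    using E_point[OF M v ins] closure_superset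
    by (intro subsetD[OF \<open>ant _ _ _ \<subseteq> pole M\<close>] ant_replicate_mem) auto
  moreover have "((+) (var_point M v (v (Reg RegA))) ^^ x) (var_point M v (v (State (init M))))
      = (0, (\<lambda>r. 0)(RegA := x), {#Inl (init M)#})"
    by (induction x) (auto simp: var_point_simps[OF v] init inc_fun_upd)
  moreover have "((+) (1, 0, {#}) ^^ n) (0, s, K) = (n, s, K)" for s :: "reg \<Rightarrow> nat" and K :: "('a + reg) multiset"
    by (induction n) auto
  ultimately show ?thesis
    by (metis (no_types, lifting) pole_simps(1) initial_config_def)
qed

section \<open>Determinism: runs of every length exclude halting\<close>

lemma step_deterministic:
  assumes M: "det_machine M" and "step M c c1" "step M c c2"
  shows "c1 = c2"
proof -
  have *: "J \<in> instrs M \<longleftrightarrow> J = I" if "I \<in> instrs M" "instr_source J = instr_source I" for I J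
    using M that by (auto simp: det_machine_def inj_on_def)
  show ?thesis
    using assms(2)
  proof cases
    case (1 p r q s)
    have "INC p r' q' \<in> instrs M \<longleftrightarrow> r' = r \<and> q' = q" "JZDEC p r' q0' q1' \<notin> instrs M" for r' q' q0' q1'
      using *[OF 1(3)] by auto
    with assms(3) show ?thesis unfolding 1 by cases auto
  next
    case (2 p r q0 q1 s)
    have "INC p r' q' \<notin> instrs M"
      "JZDEC p r' q0' q1' \<in> instrs M \<longleftrightarrow> r' = r \<and> q0' = q0 \<and> q1' = q1" for r' q' q0' q1'
      using *[OF 2(3)] by auto
    with assms(3) 2(4) show ?thesis unfolding 2(1,2) by cases auto
  next
    case (3 p r q0 q1 s)
    have "INC p r' q' \<notin> instrs M"
      "JZDEC p r' q0' q1' \<in> instrs M \<longleftrightarrow> r' = r \<and> q0' = q0 \<and> q1' = q1" for r' q' q0' q1'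
      using *[OF 3(3)] by auto
    with assms(3) 3(4) show ?thesis unfolding 3(1,2) by cases auto
  qed
qed

lemma no_step_from_final:
  assumes M: "det_machine M"
  shows "\<not> step M (final M, s) c"
proof
  assume "step M (final M, s) c"
  then have "final M \<in> instr_source ` instrs M" by cases force+
  then show False using M by (auto simp: det_machine_def)
qed

lemma runs_forever_if_long_runs:
  assumes M: "det_machine M" and long: "\<And>n. \<exists>c. (step M ^^ n) (initial_config M x) c"
  shows "runs_forever M x"
  unfolding runs_forever_def halts_def
proof
  have det: "c1 = c2" if "(step M ^^ n) c c1" "(step M ^^ n) c c2" for n c c1 c2
    using that
  proof (induction n arbitrary: c1 c2)
    case (Suc n)
    obtain d1 d2 where d: "(step M ^^ n) c d1" "step M d1 c1" "(step M ^^ n) c d2" "step M d2 c2"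
      using Suc.prems by auto
    then have "d1 = d2" using Suc.IH by simp
    then show ?case using d step_deterministic[OF M] by simp
  qed simp
  assume "\<exists>s. (step M)\<^sup>*\<^sup>* (initial_config M x) (final M, s)"
  then obtain s n where n: "(step M ^^ n) (initial_config M x) (final M, s)"
    by (auto simp: rtranclp_power)
  \<comment> \<open>A run one step longer than the halting run passes, by determinism, through the
    halting configuration and would have to leave it.\<close>
  obtain c where "(step M ^^ Suc n) (initial_config M x) c" using long by blast
  then obtain c' where c': "(step M ^^ n) (initial_config M x) c'" "step M c' c"
    by (rule relpowp_Suc_E)
  show False using c'(2) no_step_from_final[OF M] unfolding det[OF c'(1) n] by simp
qed

lemma runs_forever_iff_derivable:
  assumes "det_machine M" "distinct_vars M v" "set ins = instrs M" "set qs = states M"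
  shows "runs_forever M x \<longleftrightarrow>
    {#Star (E_fm v ins), state_var v (init M)#} + replicate_mset x (reg_var v RegA) \<turnstile> D_fm v qs"
  using derivable_if_runs_forever[OF assms(1,3,4)]
    runs_forever_if_long_runs[OF assms(1) long_run_if_derivable[OF assms]] by blast

section \<open>Structured counter programs\<close>

datatype 'r prog =
    Skip
  | Inc 'r
  | Seq "'r prog" "'r prog"  (infixr ";;" 60)
  | Case 'r "'r prog" "'r prog"
  | While 'r "'r prog"

text \<open>A successful test, in \<open>Case\<close> and in \<open>While\<close>, decrements the tested register.\<close>

inductive exec :: "'r prog \<Rightarrow> ('r \<Rightarrow> nat) \<Rightarrow> ('r \<Rightarrow> nat) \<Rightarrow> bool" where
  Skip: "exec Skip s s"
| Inc: "exec (Inc r) s (s(r := Suc (s r)))"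
| Seq: "exec P s t \<Longrightarrow> exec Q t u \<Longrightarrow> exec (P ;; Q) s u"
| Case0: "s r = 0 \<Longrightarrow> exec P s t \<Longrightarrow> exec (Case r P Q) s t"
| CaseSuc: "s r = Suc n \<Longrightarrow> exec Q (s(r := n)) t \<Longrightarrow> exec (Case r P Q) s t"
| While0: "s r = 0 \<Longrightarrow> exec (While r P) s s"
| WhileSuc: "s r = Suc n \<Longrightarrow> exec P (s(r := n)) t \<Longrightarrow> exec (While r P) t u \<Longrightarrow> exec (While r P) s u"

inductive_cases exec_SeqE: "exec (P ;; Q) s u"

lemma exec_Skip: "t = s \<Longrightarrow> exec Skip s t"
  by (simp add: exec.Skip)

lemma exec_Inc: "t = s(r := Suc (s r)) \<Longrightarrow> exec (Inc r) s t"
  by (simp add: exec.Inc)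

lemma exec_While0: "s r = 0 \<Longrightarrow> t = s \<Longrightarrow> exec (While r P) s t"
  by (simp add: exec.While0)

lemma finite_set_prog: "finite (set_prog P)"
  by (induction P) auto

primrec incs :: "'r \<Rightarrow> nat \<Rightarrow> 'r prog" where
  "incs r 0 = Skip"
| "incs r (Suc k) = (Inc r ;; incs r k)"

lemma exec_incs: "t = s(r := s r + k) \<Longrightarrow> exec (incs r k) s t"
proof (induction k arbitrary: s t)
  case 0
  then show ?case by (auto intro: exec_Skip)
next
  case (Suc k)
  show ?case
    unfolding incs.simps by (rule exec.Seq[OF exec.Inc]) (rule Suc.IH, use Suc.prems in auto)
qed

definition transfer :: "'r \<Rightarrow> 'r \<Rightarrow> nat \<Rightarrow> 'r prog" where
  "transfer r r' k = While r (incs r' k)"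

lemma exec_transfer:
  assumes "r \<noteq> r'" "t = s(r := 0, r' := s r' + k * s r)"
  shows "exec (transfer r r' k) s t"
  using assms(2)
proof (induction "s r" arbitrary: s t)
  case 0
  then show ?case using assms(1) by (auto simp: transfer_def intro!: exec_While0)
next
  case (Suc n)
  have "exec (transfer r r' k) ((s(r := n))(r' := s r' + k)) t"
    by (rule Suc.hyps(1)) (use assms(1) Suc.hyps(2)[symmetric] Suc.prems in \<open>auto simp: fun_eq_iff\<close>)
  then show ?case
    unfolding transfer_def
    by (rule exec.WhileSuc[where s = s and r = r, OF Suc.hyps(2)[symmetric] exec_incs, rotated]) (use assms(1) in auto)
qed

definition clear :: "'r \<Rightarrow> 'r prog" where
  "clear r = While r Skip"

lemma exec_clear: "t = s(r := 0) \<Longrightarrow> exec (clear r) s t"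
proof (induction "s r" arbitrary: s t)
  case 0
  then show ?case by (auto simp: clear_def intro!: exec_While0)
next
  case (Suc n)
  have "exec (clear r) (s(r := n)) t"
    by (rule Suc.hyps(1)) (use Suc.prems in auto)
  then show ?case
    unfolding clear_def by (rule exec.WhileSuc[where s = s and r = r, OF Suc.hyps(2)[symmetric] exec.Skip])
qed

text \<open>\<open>k\<close> is a scratch register from which \<open>i\<close> is restored.\<close>

definition copy :: "'r \<Rightarrow> 'r \<Rightarrow> 'r \<Rightarrow> 'r prog" where
  "copy i d k = (While i (Inc d ;; Inc k) ;; transfer k i 1)"

lemma exec_copy:
  assumes "i \<noteq> d" "i \<noteq> k" "d \<noteq> k" and "s k = 0" "t = s(d := s d + s i)"
  shows "exec (copy i d k) s t"
proof -
  have *: "exec (While i (Inc d ;; Inc k)) s (s(i := 0, d := s d + s i, k := s k + s i))" for s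
  proof (induction "s i" arbitrary: s)
    case 0
    then show ?case using assms(1-3) by (intro exec_While0) (auto simp: fun_eq_iff)
  next
    case (Suc n)
    let ?s = "s(i := n, d := Suc (s d), k := Suc (s k))"
    have "exec (Inc d ;; Inc k) (s(i := n)) ?s"
      by (rule exec.Seq[OF exec.Inc exec_Inc]) (use assms(1-3) in auto)
    moreover have "exec (While i (Inc d ;; Inc k)) ?s (?s(i := 0, d := ?s d + ?s i, k := ?s k + ?s i))"
      using assms(1-3) by (intro Suc.hyps(1)) auto
    ultimately have "exec (While i (Inc d ;; Inc k)) s (?s(i := 0, d := ?s d + ?s i, k := ?s k + ?s i))"
      using Suc.hyps(2) exec.WhileSuc by metis
    moreover have "?s(i := 0, d := ?s d + ?s i, k := ?s k + ?s i) = s(i := 0, d := s d + s i, k := s k + s i)"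
      using Suc.hyps(2)[symmetric] assms(1-3) by (auto simp: fun_eq_iff)
    ultimately show ?case by simp
  qed
  show ?thesis
    unfolding copy_def
    by (rule exec.Seq[OF * exec_transfer]) (use assms in \<open>auto simp: fun_eq_iff\<close>)
qed

section \<open>Machines for structured programs\<close>

text \<open>\<open>Skip\<close> takes two states: as no instruction is idle, it is realized by an
  increment followed by a decrement.\<close>

primrec code_len :: "'r prog \<Rightarrow> nat" where
  "code_len Skip = 2"
| "code_len (Inc r) = 1"
| "code_len (P ;; Q) = code_len P + code_len Q"
| "code_len (Case r P Q) = Suc (code_len P + code_len Q)"
| "code_len (While r P) = Suc (code_len P)"

text \<open>\<open>code P l e\<close> occupies the states \<open>l, l + 1, \<dots>, l + code_len P - 1\<close>, is entered at \<open>l\<close> and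
  left to \<open>e\<close>.\<close>

primrec code :: "reg prog \<Rightarrow> nat \<Rightarrow> nat \<Rightarrow> nat instr set" where
  "code Skip l e = {INC l RegA (Suc l), JZDEC (Suc l) RegA e e}"
| "code (Inc r) l e = {INC l r e}"
| "code (P ;; Q) l e = code P l (l + code_len P) \<union> code Q (l + code_len P) e"
| "code (Case r P Q) l e = insert (JZDEC l r (Suc l) (Suc l + code_len P))
     (code P (Suc l) e \<union> code Q (Suc l + code_len P) e)"
| "code (While r P) l e = insert (JZDEC l r e (Suc l)) (code P (Suc l) l)"

lemma code_len_pos: "code_len P > 0"
  by (induction P) auto

text \<open>Equality matters: disjoint intervals make sources unique, and a fully used interval
  leaves the exit as the only state without an instruction.\<close>

lemma source_code: "instr_source ` code P l e = {l..<l + code_len P}"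
proof (induction P arbitrary: l e)
  case (Seq P Q)
  then show ?case by (auto simp: image_Un)
next
  case (Case r P Q)
  have "instr_source ` code (Case r P Q) l e
      = insert l ({Suc l..<Suc l + code_len P} \<union> {Suc l + code_len P..<Suc l + code_len P + code_len Q})"
    using Case by (simp add: image_Un)
  also have "\<dots> = insert l {Suc l..<Suc l + code_len P + code_len Q}"
    by (subst ivl_disj_un_two(3)) simp_all
  finally show ?case unfolding set_eq_iff by (simp, arith)
next
  case (While r P)
  then show ?case by auto
qed auto

lemma finite_code: "finite (code P l e)"
  by (induction P arbitrary: l e) auto

lemma inj_on_Un_disjoint:
  "inj_on f A \<Longrightarrow> inj_on f B \<Longrightarrow> f ` A \<inter> f ` B = {} \<Longrightarrow> inj_on f (A \<union> B)"
  unfolding inj_on_def by blast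

lemma inj_on_source_code: "inj_on instr_source (code P l e)"
proof (induction P arbitrary: l e)
  case (Seq P Q)
  then show ?case
    unfolding code.simps by (intro inj_on_Un_disjoint) (auto simp: source_code)
next
  case (Case r P Q)
  have "l \<notin> instr_source ` (code P (Suc l) e \<union> code Q (Suc l + code_len P) e)"
    unfolding image_Un source_code by auto
  moreover have "inj_on instr_source (code P (Suc l) e \<union> code Q (Suc l + code_len P) e)"
    using Case by (intro inj_on_Un_disjoint) (auto simp: source_code)
  ultimately show ?case by (auto simp: inj_on_insert)
next
  case (While r P)
  have "l \<notin> instr_source ` code P (Suc l) l" unfolding source_code by auto
  then show ?case using While by (auto simp: inj_on_insert)
qed auto

lemma instr_states_code: "I \<in> code P l e \<Longrightarrow> instr_states I \<subseteq> insert e {l..<l + code_len P}"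
proof (induction P arbitrary: l e)
  case (Seq P Q)
  then show ?case using code_len_pos[of Q] by fastforce
next
  case (Case r P Q)
  then show ?case using code_len_pos[of P] code_len_pos[of Q] by fastforce
next
  case (While r P)
  then show ?case using code_len_pos[of P] by fastforce
qed auto

definition machine_of :: "reg prog \<Rightarrow> nat machine" where
  "machine_of P = \<lparr>states = {0..code_len P}, init = 0, final = code_len P, instrs = code P 0 (code_len P)\<rparr>"

lemma machine_of_simps [simp]:
  "states (machine_of P) = {0..code_len P}" "init (machine_of P) = 0"
  "final (machine_of P) = code_len P" "instrs (machine_of P) = code P 0 (code_len P)"
  by (simp_all add: machine_of_def)

lemma det_machine_machine_of: "det_machine (machine_of P)"
  unfolding det_machine_def machine_of_simps source_code
  using instr_states_code[of _ P 0 "code_len P"]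
  by (fastforce simp: finite_code inj_on_source_code)

text \<open>The transitive closure records at least one step, so that the iterations of a diverging
  loop add up to runs of unbounded length.\<close>

lemma code_exec:
  assumes "exec P s t" "code P l e \<subseteq> instrs M"
  shows "(step M)\<^sup>+\<^sup>+ (l, s) (e, t)"
  using assms
proof (induction arbitrary: l e)
  case (Skip s)
  have "step M (l, s) (Suc l, s(RegA := s RegA + 1))"
    using Skip by (intro step.intros) auto
  moreover have "step M (Suc l, s(RegA := s RegA + 1)) (e, (s(RegA := s RegA + 1))(RegA := (s(RegA := s RegA + 1)) RegA - 1))"
    using Skip by (intro step.intros(3)) auto
  ultimately show ?case by (simp add: tranclp.trancl_into_trancl[OF tranclp.r_into_trancl])
next
  case (Inc r s)
  then show ?case using step.intros(1)[of l r e M s] by (intro tranclp.r_into_trancl)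
      (simp add: fun_upd_def)
next
  case (Seq P s t Q u)
  have "(step M)\<^sup>+\<^sup>+ (l, s) (l + code_len P, t)" "(step M)\<^sup>+\<^sup>+ (l + code_len P, t) (e, u)"
    using Seq by auto
  then show ?case by (rule tranclp_trans)
next
  case (Case0 s r P t Q)
  have "step M (l, s) (Suc l, s)"
    using Case0 by (intro step.intros(2)) auto
  then show ?case using Case0 by (auto intro: tranclp_into_tranclp2)
next
  case (CaseSuc s r n Q t P)
  have "step M (l, s) (Suc l + code_len P, s(r := s r - 1))"
    using CaseSuc by (intro step.intros(3)) auto
  then show ?case using CaseSuc by (auto intro: tranclp_into_tranclp2 simp: fun_upd_def)
next
  case (While0 s r P)
  have "step M (l, s) (e, s)"
    using While0 by (intro step.intros(2)) auto
  then show ?case by auto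
next
  case (WhileSuc s r n P t u)
  have "step M (l, s) (Suc l, s(r := s r - 1))"
    using WhileSuc by (intro step.intros(3)) auto
  moreover have "(step M)\<^sup>+\<^sup>+ (Suc l, s(r := n)) (l, t)" "(step M)\<^sup>+\<^sup>+ (l, t) (e, u)"
    using WhileSuc by (auto simp: fun_upd_def)
  ultimately show ?case using WhileSuc.hyps by (auto intro: tranclp_into_tranclp2 tranclp_trans)
qed

text \<open>\<open>exec\<close> relates only terminating executions, so divergence is stated through
  machine runs of every length. Quantifying over machine and position makes it
  compositional.\<close>

definition diverges :: "reg prog \<Rightarrow> (reg \<Rightarrow> nat) \<Rightarrow> bool" where
  "diverges P s \<longleftrightarrow> (\<forall>M l e n. code P l e \<subseteq> instrs M \<longrightarrow> (\<exists>c. (step M ^^ n) (l, s) c))"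

lemma relpowp_prefix: "((R :: 'a \<Rightarrow> 'a \<Rightarrow> bool) ^^ (m + n)) x z \<Longrightarrow> \<exists>y. (R ^^ m) x y"
  by (auto simp: relpowp_add)

lemma diverges_Seq:
  assumes "exec P s t" "diverges Q t"
  shows "diverges (P ;; Q) s"
  unfolding diverges_def
proof (intro allI impI)
  fix M :: "nat machine" and l e n
  assume code: "code (P ;; Q) l e \<subseteq> instrs M"
  then have "(step M)\<^sup>+\<^sup>+ (l, s) (l + code_len P, t)"
    using code_exec[OF assms(1)] by simp
  then have "\<exists>m>0. (step M ^^ m) (l, s) (l + code_len P, t)"
    by (simp only: tranclp_power)
  then obtain m where m: "(step M ^^ m) (l, s) (l + code_len P, t)"
    by (elim exE conjE) (rule that)
  have "code Q (l + code_len P) e \<subseteq> instrs M" using code by simp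
  from assms(2)[unfolded diverges_def, rule_format, OF this]
  obtain c where "(step M ^^ n) (l + code_len P, t) c" by (rule exE)
  with m have "(step M ^^ (n + m)) (l, s) c"
    by (subst add.commute) (auto simp: relpowp_add)
  then show "\<exists>c. (step M ^^ n) (l, s) c" by (rule relpowp_prefix)
qed

text \<open>\<open>S\<close> is a loop invariant that implies the test. Every round takes at least
  one step, so \<open>n\<close> rounds give a run of length at least \<open>n\<close>.\<close>

lemma diverges_While:
  assumes "s \<in> S" and S: "\<And>s. s \<in> S \<Longrightarrow> \<exists>n t. s r = Suc n \<and> exec P (s(r := n)) t \<and> t \<in> S"
  shows "diverges (While r P) s"
  unfolding diverges_def
proof (intro allI impI)
  fix M :: "nat machine" and l e n
  assume code: "code (While r P) l e \<subseteq> instrs M"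
  have "\<exists>t\<in>S. \<exists>m\<ge>n. (step M ^^ m) (l, s) (l, t)" for n
  proof (induction n)
    case 0
    then show ?case using assms(1) by (intro bexI[of _ s] exI[of _ 0]) auto
  next
    case (Suc n)
    then obtain t m where t: "t \<in> S" "m \<ge> n" "(step M ^^ m) (l, s) (l, t)"
    by (elim bexE exE conjE) (rule that)
    obtain k u where u: "t r = Suc k" "exec P (t(r := k)) u" "u \<in> S" using S t by blast
    have "step M (l, t) (Suc l, t(r := t r - 1))"
      using code u by (intro step.intros(3)) auto
    moreover have "(step M)\<^sup>+\<^sup>+ (Suc l, t(r := k)) (l, u)"
      using code_exec[OF u(2)] code by simp
    ultimately have "(step M)\<^sup>+\<^sup>+ (l, t) (l, u)"
      using u(1) by (auto intro: tranclp_into_tranclp2)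
    then have "\<exists>i>0. (step M ^^ i) (l, t) (l, u)"
      by (simp only: tranclp_power)
    then obtain i where i: "i > 0" "(step M ^^ i) (l, t) (l, u)"
      by (elim exE conjE) (rule that)
    then have "(step M ^^ (m + i)) (l, s) (l, u)"
      using t(3) by (auto simp: relpowp_add)
    then show ?case using u(3) t(2) i(1) by (intro bexI[of _ u] exI[of _ "m + i"]) auto
  qed
  from this[of n] obtain t m where "m \<ge> n" "(step M ^^ m) (l, s) (l, t)"
    by (elim bexE exE conjE) (rule that)
  then show "\<exists>c. (step M ^^ n) (l, s) c"
    using relpowp_prefix[of n "m - n" "step M"] by auto
qed

lemma halts_machine_of:
  assumes "exec P ((\<lambda>r. 0)(RegA := x)) t"
  shows "halts (machine_of P) x"
proof -
  have "(step (machine_of P))\<^sup>+\<^sup>+ (0, (\<lambda>r. 0)(RegA := x)) (code_len P, t)"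
    by (rule code_exec[OF assms]) simp
  then show ?thesis
    unfolding halts_def initial_config_def machine_of_simps by (blast intro: tranclp_into_rtranclp)
qed

lemma runs_forever_machine_of:
  assumes "diverges P ((\<lambda>r. 0)(RegA := x))"
  shows "runs_forever (machine_of P) x"
proof (rule runs_forever_if_long_runs[OF det_machine_machine_of])
  have "code P 0 (code_len P) \<subseteq> instrs (machine_of P)" by simp
  then show "\<exists>c. (step (machine_of P) ^^ n) (initial_config (machine_of P) x) c" for n
    using assms[unfolded diverges_def, rule_format, of 0 "code_len P" "machine_of P" n]
    unfolding initial_config_def by (simp only: machine_of_simps)
qed

section \<open>Reduction to three registers\<close>

text \<open>A store \<open>s\<close> of arbitrarily many registers is kept in register \<open>a\<close> as the number
  \<open>\<Prod>\<^sub>i p\<^sub>i\<^sup>s\<^sup>i\<close>.\<close>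

fun store3 :: "nat \<Rightarrow> nat \<Rightarrow> nat \<Rightarrow> reg \<Rightarrow> nat" where
  "store3 a b c RegA = a"
| "store3 a b c RegB = b"
| "store3 a b c RegC = c"

lemma store3_eqI: "s RegA = a \<Longrightarrow> s RegB = b \<Longrightarrow> s RegC = c \<Longrightarrow> s = store3 a b c"
  by (rule ext, rename_tac r, case_tac r) auto

lemma store3_upd [simp]:
  "(store3 a b c)(RegA := x) = store3 x b c"
  "(store3 a b c)(RegB := x) = store3 a x c"
  "(store3 a b c)(RegC := x) = store3 a b x"
  by (rule store3_eqI; simp)+

section \<open>Multiplication, division and divisibility by a constant\<close>

definition mul_prog :: "nat \<Rightarrow> reg prog" where
  "mul_prog k = (transfer RegA RegB k ;; transfer RegB RegA 1)"

lemma exec_mul_prog: "exec (mul_prog k) (store3 a 0 0) (store3 (k * a) 0 0)"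
  unfolding mul_prog_def by (rule exec.Seq[OF exec_transfer exec_transfer]) auto

primrec decs :: "'r \<Rightarrow> nat \<Rightarrow> 'r prog" where
  "decs r 0 = Skip"
| "decs r (Suc k) = Case r Skip (decs r k)"

lemma exec_decs: "s r = k + m \<Longrightarrow> t = s(r := m) \<Longrightarrow> exec (decs r k) s t"
proof (induction k arbitrary: s)
  case 0
  then have "t = s" by (simp add: fun_eq_iff)
  then show ?case by (simp add: exec.Skip)
next
  case (Suc k)
  have "exec (decs r k) (s(r := k + m)) t"
    by (rule Suc.IH) (simp_all add: Suc.prems(2) fun_eq_iff)
  then show ?case using Suc.prems by (auto intro: exec.CaseSuc[of _ _ "k + m"])
qed

text \<open>The test of \<open>While\<close> already removes one unit, hence
  \<open>k - 1\<close>.\<close>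

definition div_prog :: "nat \<Rightarrow> reg prog" where
  "div_prog k = (While RegA (decs RegA (k - 1) ;; Inc RegB) ;; transfer RegB RegA 1)"

lemma exec_div_prog:
  assumes "k > 0"
  shows "exec (div_prog k) (store3 (k * m) 0 0) (store3 m 0 0)"
proof -
  have "exec (While RegA (decs RegA (k - 1) ;; Inc RegB)) (store3 (k * m) b 0) (store3 0 (b + m) 0)" for b
  proof (induction m arbitrary: b)
    case 0
    then show ?case by (auto intro: exec_While0)
  next
    case (Suc m)
    have "exec (decs RegA (k - 1) ;; Inc RegB) (store3 (k - 1 + k * m) b 0) (store3 (k * m) (Suc b) 0)"
      using exec_decs[of "store3 (k - 1 + k * m) b 0" RegA "k - 1" "k * m"]
      by (intro exec.Seq[OF _ exec_Inc]) auto
    moreover have "k * Suc m = Suc (k - 1 + k * m)" using assms by simp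
    ultimately show ?case
      using exec.WhileSuc[of "store3 (k * Suc m) b 0" RegA "k - 1 + k * m", OF _ _ Suc[of "Suc b"]] by simp
  qed
  from this[of 0] show ?thesis
    unfolding div_prog_def by (rule exec.Seq[OF _ exec_transfer]) auto
qed

text \<open>Divisibility of \<open>a\<close> by \<open>k\<close>: register \<open>b\<close> counts the \<open>k\<close>-blocks taken off \<open>a\<close>, and
  \<open>c = 1\<close> requests another block. When \<open>a\<close> runs out inside a block, \<open>a\<close> is restored
  and \<open>b\<close> receives the answer.\<close>

primrec take_block :: "nat \<Rightarrow> nat \<Rightarrow> reg prog" where
  "take_block k 0 = (Inc RegB ;; Inc RegC)"
| "take_block k (Suc i) = Case RegA
     (transfer RegB RegA k ;; incs RegA (k - Suc i) ;; (if k - Suc i = 0 then Inc RegB else Skip))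
     (take_block k i)"

lemma exec_take_block: "exec (take_block k i) (store3 (i + m) b 0) (store3 m (Suc b) 1)"
proof (induction i)
  case 0
  show ?case unfolding take_block.simps by (rule exec.Seq[OF exec.Inc exec_Inc]) simp
next
  case (Suc i)
  then show ?case by (auto intro: exec.CaseSuc[of _ _ "i + m"])
qed

text \<open>With \<open>i\<close> units of the block still to take, \<open>k - i\<close> are already
  gone, so the original number is \<open>k * b + (k - i) + a\<close>. As
  \<open>k - i + a < k\<close>, it is a multiple of \<open>k\<close> only if this remainder is
  0.\<close>

lemma exec_take_block_fail:
  assumes "a < i" "i \<le> k"
  shows "exec (take_block k i) (store3 a b 0)
    (store3 (k * b + (k - i) + a) (if k - i + a = 0 then 1 else 0) 0)"
  using assms
proof (induction i arbitrary: a)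
  case 0
  then show ?case by simp
next
  case (Suc i)
  show ?case
  proof (cases a)
    case 0
    have "exec (if k - Suc i = 0 then Inc RegB else Skip) (store3 (k * b + (k - Suc i)) 0 0)
        (store3 (k * b + (k - Suc i)) (if k - Suc i = 0 then 1 else 0) 0)"
      by (auto intro: exec_Inc exec_Skip)
    then have "exec (transfer RegB RegA k ;; incs RegA (k - Suc i) ;; (if k - Suc i = 0 then Inc RegB else Skip))
        (store3 0 b 0) (store3 (k * b + (k - Suc i)) (if k - Suc i = 0 then 1 else 0) 0)"
      by (intro exec.Seq[OF exec_transfer exec.Seq[OF exec_incs]]) auto
    then show ?thesis using 0 by (auto intro: exec.Case0)
  next
    case (Suc a')
    have "exec (take_block k i) (store3 a' b 0) (store3 (k * b + (k - i) + a') (if k - i + a' = 0 then 1 else 0) 0)"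
      using Suc.IH[of a'] Suc.prems Suc by auto
    moreover have "k - i + a' = k - Suc i + a" using Suc Suc.prems by simp
    ultimately have "exec (take_block k i) (store3 a' b 0)
        (store3 (k * b + (k - Suc i) + a) (if k - Suc i + a = 0 then 1 else 0) 0)"
      by (simp only: add.assoc)
    then show ?thesis
      using Suc unfolding take_block.simps by (intro exec.CaseSuc[of _ _ a']) simp_all
  qed
qed

definition dvd_prog :: "nat \<Rightarrow> reg prog" where
  "dvd_prog k = (Inc RegC ;; While RegC (take_block k k))"

text \<open>\<open>k * b + a\<close> is the loop invariant, and strong induction on \<open>a\<close>
  follows the removal of full blocks. The test of \<open>While\<close> resets \<open>c\<close> to 0
  before each block.\<close>

lemma exec_dvd_prog:
  assumes "k > 0"
  shows "exec (dvd_prog k) (store3 a 0 0) (store3 a (if k dvd a then 1 else 0) 0)"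
proof -
  have "exec (While RegC (take_block k k)) (store3 a b 1) (store3 (k * b + a) (if k dvd a then 1 else 0) 0)" for b
  proof (induction a arbitrary: b rule: less_induct)
    case (less a)
    show ?case
    proof (cases "a < k")
      case True
      then have "k dvd a \<longleftrightarrow> a = 0" using dvd_imp_le by auto
      then have "exec (take_block k k) (store3 a b 0) (store3 (k * b + a) (if k dvd a then 1 else 0) 0)"
        using exec_take_block_fail[OF True, of k b] by simp
      then show ?thesis
        by (intro exec.WhileSuc[where n = 0, OF _ _ exec_While0[OF _ refl]]) simp_all
    next
      case False
      then obtain m where m: "a = k + m" using le_Suc_ex not_less by blast
      have "exec (While RegC (take_block k k)) (store3 m (Suc b) 1)
          (store3 (k * Suc b + m) (if k dvd m then 1 else 0) 0)"
        using less.IH[of m "Suc b"] m assms by simp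
      moreover have "k * Suc b + m = k * b + a" "k dvd m \<longleftrightarrow> k dvd a"
        using m by simp_all
      ultimately have "exec (While RegC (take_block k k)) (store3 m (Suc b) 1)
          (store3 (k * b + a) (if k dvd a then 1 else 0) 0)"
        by (simp only:)
      from exec.WhileSuc[OF _ _ this, of "store3 a b 1" 0] show ?thesis
        using exec_take_block[of k k m b] m by simp
    qed
  qed
  from this[of 0] show ?thesis
    unfolding dvd_prog_def by (intro exec.Seq[OF exec_Inc]) auto
qed

section \<open>Stores as products of prime powers\<close>

definition nth_prime :: "nat \<Rightarrow> nat" where
  "nth_prime = Infinite_Set.enumerate {p. prime p}"

lemma prime_nth_prime: "prime (nth_prime i)"
  using enumerate_in_set[OF primes_infinite] by (simp add: nth_prime_def)

lemma nth_prime_pos: "nth_prime i > 0"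
  using prime_nth_prime prime_gt_0_nat by blast

lemma nth_prime_eq_iff: "nth_prime i = nth_prime j \<longleftrightarrow> i = j"
  using strict_mono_enumerate[OF primes_infinite] by (simp add: nth_prime_def strict_mono_eq)

definition enc :: "nat \<Rightarrow> (nat \<Rightarrow> nat) \<Rightarrow> nat" where
  "enc K s = (\<Prod>i<K. nth_prime i ^ s i)"

lemma enc_upd:
  assumes "i < K"
  shows "enc K (s(i := n + s i)) = nth_prime i ^ n * enc K s"
proof -
  have "enc K s = nth_prime i ^ s i * (\<Prod>j\<in>{..<K} - {i}. nth_prime j ^ s j)" for s
    using assms unfolding enc_def by (simp add: prod.remove)
  then show ?thesis by (simp add: power_add)
qed

lemma enc_Suc: "i < K \<Longrightarrow> enc K (s(i := Suc (s i))) = nth_prime i * enc K s"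
  using enc_upd[of i K s 1] by simp

lemma enc_dec:
  assumes "i < K" "s i = Suc n"
  shows "enc K s = nth_prime i * enc K (s(i := n))"
  using enc_Suc[OF assms(1), of "s(i := n)"] assms(2) by (simp add: fun_upd_idem)

lemma nth_prime_dvd_enc: "i < K \<Longrightarrow> nth_prime i dvd enc K s \<longleftrightarrow> s i > 0"
proof
  assume "nth_prime i dvd enc K s"
  then obtain j where "nth_prime i dvd nth_prime j ^ s j"
    unfolding enc_def using prime_nth_prime by (auto simp: prime_dvd_prod_iff)
  moreover from this have "s j > 0"
    using prime_nth_prime[of i] by (cases "s j") auto
  moreover have "nth_prime i = nth_prime j"
    by (rule primes_dvd_imp_eq[OF prime_nth_prime prime_nth_prime prime_dvd_power[OF prime_nth_prime]]) fact
  ultimately show "s i > 0" by (simp add: nth_prime_eq_iff)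
next
  assume "i < K" "s i > 0"
  then show "nth_prime i dvd enc K s"
    using enc_dec[of i K s "s i - 1"] by simp
qed

text \<open>Increment, decrement and test become multiplication, division and divisibility. The
  answer in register \<open>b\<close> is consumed by the branching on \<open>b\<close>, so the
  translated parts start with \<open>b\<close> and \<open>c\<close> zero; the loop body must end by
  computing the answer anew.\<close>

primrec tr :: "nat prog \<Rightarrow> reg prog" where
  "tr Skip = Skip"
| "tr (Inc i) = mul_prog (nth_prime i)"
| "tr (P ;; Q) = (tr P ;; tr Q)"
| "tr (Case i P Q) = (dvd_prog (nth_prime i) ;; Case RegB (tr P) (div_prog (nth_prime i) ;; tr Q))"
| "tr (While i P) = (dvd_prog (nth_prime i) ;;
     While RegB (div_prog (nth_prime i) ;; tr P ;; dvd_prog (nth_prime i)))"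

lemma exec_tr_test:
  "i < K \<Longrightarrow> exec (dvd_prog (nth_prime i)) (store3 (enc K s) 0 0) (store3 (enc K s) (if s i > 0 then 1 else 0) 0)"
  using exec_dvd_prog[OF nth_prime_pos] nth_prime_dvd_enc[of i K s] by metis

lemma exec_tr_dec:
  "i < K \<Longrightarrow> s i = Suc n \<Longrightarrow> exec (div_prog (nth_prime i)) (store3 (enc K s) 0 0) (store3 (enc K (s(i := n))) 0 0)"
  using exec_div_prog[OF nth_prime_pos] by (simp add: enc_dec)

lemma exec_tr:
  assumes "exec P s t" "set_prog P \<subseteq> {..<K}"
  shows "exec (tr P) (store3 (enc K s) 0 0) (store3 (enc K t) 0 0)"
  using assms
proof (induction)
  case (Inc r s)
  then show ?case using exec_mul_prog[of "nth_prime r" "enc K s"] enc_Suc[of r K s]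
    by (simp add: fun_upd_def)
next
  case (Case0 s r P t Q)
  then show ?case
    using exec_tr_test[of r K s] by (auto intro!: exec.Seq exec.Case0)
next
  case (CaseSuc s r n Q t P)
  have "exec (tr Q) (store3 (enc K (s(r := n))) 0 0) (store3 (enc K t) 0 0)"
    using CaseSuc by (simp add: fun_upd_def)
  then have "exec (div_prog (nth_prime r) ;; tr Q) (store3 (enc K s) 0 0) (store3 (enc K t) 0 0)"
    using CaseSuc.hyps(1) CaseSuc.prems by (intro exec.Seq[OF exec_tr_dec]) auto
  then have "exec (Case RegB (tr P) (div_prog (nth_prime r) ;; tr Q)) (store3 (enc K s) 1 0) (store3 (enc K t) 0 0)"
    using exec.CaseSuc[of "store3 (enc K s) 1 0" RegB 0] by simp
  then show ?case
    using CaseSuc.hyps(1) CaseSuc.prems exec_tr_test[of r K s] by (simp add: exec.Seq)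
next
  case (While0 s r P)
  then show ?case
    using exec_tr_test[of r K s] by (auto intro!: exec.Seq exec.While0)
next
  case (WhileSuc s r n P t u)
  let ?B = "div_prog (nth_prime r) ;; tr P ;; dvd_prog (nth_prime r)"
  have r: "r < K" using WhileSuc.prems by simp
  \<comment> \<open>The induction hypothesis for the remaining rounds begins with a test; the store
    \<open>x\<close> after that test is where one round of \<open>?B\<close> ends.\<close>
  obtain x where x: "exec (dvd_prog (nth_prime r)) (store3 (enc K t) 0 0) x"
    "exec (While RegB ?B) x (store3 (enc K u) 0 0)"
    using WhileSuc by (auto elim: exec_SeqE)
  have "exec (tr P) (store3 (enc K (s(r := n))) 0 0) (store3 (enc K t) 0 0)"
    using WhileSuc by (simp add: fun_upd_def)
  then have "exec ?B (store3 (enc K s) 0 0) x"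
    using WhileSuc.hyps(1) r x(1) by (intro exec.Seq[OF exec_tr_dec exec.Seq])
  then have "exec (While RegB ?B) (store3 (enc K s) 1 0) (store3 (enc K u) 0 0)"
    using exec.WhileSuc[OF _ _ x(2), of "store3 (enc K s) 1 0" 0] by simp
  then show ?case
    using WhileSuc.hyps(1) exec_tr_test[OF r, of s] by (simp add: exec.Seq)
qed (auto intro: exec.intros)

section \<open>Compiling recursive functions\<close>

primrec run_all :: "(nat list \<Rightarrow> nat \<Rightarrow> nat \<Rightarrow> nat prog) list \<Rightarrow> nat list \<Rightarrow> nat \<Rightarrow> nat \<Rightarrow> nat prog" where
  "run_all [] is d k = Skip"
| "run_all (c # cs) is d k = (c is d k ;; run_all cs is (Suc d) k)"

primrec clear_all :: "nat \<Rightarrow> nat \<Rightarrow> nat prog" where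
  "clear_all d 0 = Skip"
| "clear_all d (Suc m) = (clear d ;; clear_all (Suc d) m)"

text \<open>\<open>compile f is d k\<close> evaluates \<open>f\<close> on the registers \<open>is\<close> into register \<open>d\<close>, with the registers
  from \<open>k\<close> on as scratch space, which has to be zero and is left zero.\<close>

primrec compile :: "recf \<Rightarrow> nat list \<Rightarrow> nat \<Rightarrow> nat \<Rightarrow> nat prog" where
  "compile Zr is d k = Skip"
| "compile Sc is d k = (copy (hd is) d k ;; Inc d)"
| "compile (Proj i) is d k = copy (is ! i) d k"
| "compile (Comp f gs) is d k =
     (run_all (map compile gs) is k (k + length gs) ;;
      compile f [k..<k + length gs] d (k + length gs) ;;
      clear_all k (length gs))"
| "compile (PrimRec f g) is d k =
     (compile f (tl is) d k ;;
      copy (hd is) k (k + 1) ;;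
      While k (compile g ((k + 1) # d # tl is) (k + 2) (k + 3) ;;
        clear d ;; transfer (k + 2) d 1 ;; Inc (k + 1)) ;;
      clear (k + 1))"
| "compile (Mu f) is d k =
     (compile f (d # is) k (k + 1) ;;
      While k (clear k ;; Inc d ;; compile f (d # is) k (k + 1)))"

definition compiles_to :: "recf \<Rightarrow> (nat list \<Rightarrow> nat \<Rightarrow> nat \<Rightarrow> nat prog) \<Rightarrow> bool" where
  "compiles_to f c \<longleftrightarrow> (\<forall>is d k s y. evaluates f (map s is) y \<longrightarrow> set is \<subseteq> {..<k} \<longrightarrow> d < k \<longrightarrow>
     d \<notin> set is \<longrightarrow> s d = 0 \<longrightarrow> (\<forall>j\<ge>k. s j = 0) \<longrightarrow> exec (c is d k) s (s(d := y)))"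

lemma compiles_toI:
  assumes "\<And>is d k s y. evaluates f (map s is) y \<Longrightarrow> set is \<subseteq> {..<k} \<Longrightarrow> d < k \<Longrightarrow>
     d \<notin> set is \<Longrightarrow> s d = 0 \<Longrightarrow> (\<And>j. j \<ge> k \<Longrightarrow> s j = 0) \<Longrightarrow> exec (c is d k) s (s(d := y))"
  shows "compiles_to f c"
  using assms unfolding compiles_to_def by blast

lemma compiles_toD:
  assumes "compiles_to f c" "evaluates f xs y" "map s is = xs" "set is \<subseteq> {..<k}" "d < k"
    "d \<notin> set is" "s d = 0" "\<And>j. j \<ge> k \<Longrightarrow> s j = 0" "t = s(d := y)"
  shows "exec (c is d k) s t"
  using assms unfolding compiles_to_def by blast

inductive_cases evaluates_ZrE: "evaluates Zr xs y"
inductive_cases evaluates_ScE: "evaluates Sc xs y"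
inductive_cases evaluates_ProjE: "evaluates (Proj i) xs y"
inductive_cases evaluates_CompE: "evaluates (Comp f gs) xs y"
inductive_cases evaluates_PrimRecE: "evaluates (PrimRec f g) xs y"
inductive_cases evaluates_PrimRec0E: "evaluates (PrimRec f g) (0 # xs) y"
inductive_cases evaluates_PrimRecSucE: "evaluates (PrimRec f g) (Suc n # xs) y"
inductive_cases evaluates_MuE: "evaluates (Mu f) xs y"

lemma exec_run_all:
  assumes "list_all2 (\<lambda>g y. evaluates g xs y) gs ys"
    and "\<And>g. g \<in> set gs \<Longrightarrow> compiles_to g (compile g)"
    and "map s is = xs" "set is \<subseteq> {..<d}" "d + length gs \<le> k" "\<And>j. j \<ge> d \<Longrightarrow> s j = 0"
  shows "exec (run_all (map compile gs) is d k) s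
    (\<lambda>j. if d \<le> j \<and> j < d + length ys then ys ! (j - d) else s j)"
  using assms
proof (induction gs ys arbitrary: d s rule: list_all2_induct)
  case Nil
  show ?case unfolding list.map run_all.simps by (rule exec_Skip) (auto simp: fun_eq_iff)
next
  case (Cons g gs y ys)
  let ?t = "s(d := y)"
  have "exec (compile g is d k) s ?t"
    by (rule compiles_toD[OF Cons.prems(1)]) (use Cons in \<open>auto simp: subset_iff\<close>)
  moreover have "exec (run_all (map compile gs) is (Suc d) k) ?t
      (\<lambda>j. if Suc d \<le> j \<and> j < Suc d + length ys then ys ! (j - Suc d) else ?t j)"
    by (rule Cons.IH) (use Cons.prems in \<open>auto simp: subset_iff\<close>)
  moreover have "(\<lambda>j. if Suc d \<le> j \<and> j < Suc d + length ys then ys ! (j - Suc d) else ?t j)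
      = (\<lambda>j. if d \<le> j \<and> j < d + length (y # ys) then (y # ys) ! (j - d) else s j)"
    by (auto simp: fun_eq_iff nth_Cons' Suc_diff_Suc not_less_eq_eq)
  ultimately show ?case by (simp add: exec.Seq del: fun_upd_apply)
qed

lemma exec_clear_all: "t = (\<lambda>j. if d \<le> j \<and> j < d + m then 0 else s j) \<Longrightarrow> exec (clear_all d m) s t"
proof (induction m arbitrary: d s t)
  case 0
  show ?case unfolding clear_all.simps 0 by (rule exec_Skip) (auto simp: fun_eq_iff)
next
  case (Suc m)
  show ?case
    unfolding clear_all.simps by (rule exec.Seq[OF exec_clear[OF refl]], rule Suc.IH) (auto simp: Suc.prems fun_eq_iff)
qed

lemma compiles_to_Comp:
  assumes f: "compiles_to f (compile f)" and gs: "\<And>g. g \<in> set gs \<Longrightarrow> compiles_to g (compile g)"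
  shows "compiles_to (Comp f gs) (compile (Comp f gs))"
proof (rule compiles_toI)
  fix "is" :: "nat list" and d k :: nat and s y
  assume ev: "evaluates (Comp f gs) (map s is) y" and "is": "set is \<subseteq> {..<k}" "d < k" "d \<notin> set is"
    and s: "s d = 0" "\<And>j. j \<ge> k \<Longrightarrow> s j = 0"
  let ?m = "length gs"
  from ev obtain ys where ys: "list_all2 (\<lambda>g y. evaluates g (map s is) y) gs ys" "evaluates f ys y"
    by (rule evaluates_CompE)
  then have len: "length ys = ?m" by (simp add: list_all2_lengthD)
  let ?t = "\<lambda>j. if k \<le> j \<and> j < k + length ys then ys ! (j - k) else s j"
  have 1: "exec (run_all (map compile gs) is k (k + ?m)) s ?t"
    by (rule exec_run_all[OF ys(1) gs]) (use "is" s in auto)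
  have 2: "exec (compile f [k..<k + ?m] d (k + ?m)) ?t (?t(d := y))"
    by (rule compiles_toD[OF f ys(2)]) (use "is" s len in \<open>auto intro: nth_equalityI\<close>)
  have 3: "exec (clear_all k ?m) (?t(d := y)) (s(d := y))"
    by (rule exec_clear_all) (use "is" s len in \<open>auto simp: fun_eq_iff\<close>)
  show "exec (compile (Comp f gs) is d k) s (s(d := y))"
    unfolding compile.simps by (rule exec.Seq[OF 1 exec.Seq[OF 2 3]])
qed

lemma compiles_to_PrimRec:
  assumes f: "compiles_to f (compile f)" and g: "compiles_to g (compile g)"
  shows "compiles_to (PrimRec f g) (compile (PrimRec f g))"
proof (rule compiles_toI)
  fix "is" :: "nat list" and d k :: nat and s y
  assume ev: "evaluates (PrimRec f g) (map s is) y" and is0: "set is \<subseteq> {..<k}" "d < k" "d \<notin> set is"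
    and s: "s d = 0" "\<And>j. j \<ge> k \<Longrightarrow> s j = 0"
  from ev obtain i js where "is": "is = i # js"
    by (cases "is") (auto elim: evaluates_PrimRecE)
  note reg = is0[unfolded "is"]
  let ?xs = "map s js"
  let ?B = "compile g ((k + 1) # d # js) (k + 2) (k + 3) ;; clear d ;; transfer (k + 2) d 1 ;; Inc (k + 1)"
  \<comment> \<open>\<open>j\<close> counts the rounds still to run, \<open>n\<close> is the
    recursion index reached, \<open>z\<close> the value there.\<close>
  let ?s = "\<lambda>j n z. s(k := j, k + 1 := n, d := z)"
  have body: "exec ?B (?s j n z) (?s j (Suc n) z')" if "evaluates g (n # z # ?xs) z'" for j n z z'
  proof -
    have 1: "exec (compile g ((k + 1) # d # js) (k + 2) (k + 3)) (?s j n z) ((?s j n z)(k + 2 := z'))"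
      by (rule compiles_toD[OF g that]) (use reg s in \<open>auto simp: subset_iff\<close>)
    have 2: "exec (clear d) ((?s j n z)(k + 2 := z')) ((?s j n 0)(k + 2 := z'))"
      by (rule exec_clear) (use reg in \<open>auto simp: fun_eq_iff\<close>)
    have 3: "exec (transfer (k + 2) d 1) ((?s j n 0)(k + 2 := z')) (?s j n z')"
      by (rule exec_transfer) (use reg s in \<open>auto simp: fun_eq_iff\<close>)
    have 4: "exec (Inc (k + 1)) (?s j n z') (?s j (Suc n) z')"
      by (rule exec_Inc) (use reg in \<open>auto simp: fun_eq_iff\<close>)
    show ?thesis by (rule exec.Seq[OF 1 exec.Seq[OF 2 exec.Seq[OF 3 4]]])
  qed
  \<comment> \<open>Evaluation unfolds from \<open>n\<close> down to 0, while the program counts up.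
    The claim therefore goes backwards: an execution of the loop from index \<open>n\<close> with
    \<open>j\<close> rounds left extends to one from index 0 with \<open>j + n\<close> rounds
    left.\<close>
  have loop: "\<exists>z0. evaluates f ?xs z0 \<and>
      (\<forall>j t. exec (While k ?B) (?s j n z) t \<longrightarrow> exec (While k ?B) (?s (j + n) 0 z0) t)"
    if "evaluates (PrimRec f g) (n # ?xs) z" for n z
    using that
  proof (induction n arbitrary: z)
    case 0
    then show ?case by (auto elim: evaluates_PrimRec0E)
  next
    case (Suc n)
    from Suc.prems obtain z1 where z1: "evaluates (PrimRec f g) (n # ?xs) z1" "evaluates g (n # z1 # ?xs) z"
      by (rule evaluates_PrimRecSucE)
    from Suc.IH[OF z1(1)] obtain z0 where z0: "evaluates f ?xs z0"
      "\<And>j t. exec (While k ?B) (?s j n z1) t \<Longrightarrow> exec (While k ?B) (?s (j + n) 0 z0) t"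
      by blast
    have "exec (While k ?B) (?s (j + Suc n) 0 z0) t" if t: "exec (While k ?B) (?s j (Suc n) z) t" for j t
    proof -
      have "exec (While k ?B) (?s (Suc j) n z1) t"
      proof (rule exec.WhileSuc[OF _ _ t])
        show "?s (Suc j) n z1 k = Suc j" using reg by simp
        have "(?s (Suc j) n z1)(k := j) = ?s j n z1" using reg by (auto simp: fun_eq_iff)
        then show "exec ?B ((?s (Suc j) n z1)(k := j)) (?s j (Suc n) z)"
          using body[OF z1(2), of j] by (simp only:)
      qed
      then show ?thesis using z0(2)[of "Suc j" t] by simp
    qed
    then show ?case using z0(1) by blast
  qed
  from ev "is" have "evaluates (PrimRec f g) (s i # ?xs) y" by simp
  from loop[OF this] obtain z0 where z0: "evaluates f ?xs z0"
    "\<forall>j t. exec (While k ?B) (?s j (s i) y) t \<longrightarrow> exec (While k ?B) (?s (j + s i) 0 z0) t"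
    by blast
  have 1: "exec (compile f js d k) s (s(d := z0))"
    by (rule compiles_toD[OF f z0(1)]) (use reg s in auto)
  have 2: "exec (copy i k (k + 1)) (s(d := z0)) (?s (s i) 0 z0)"
    by (rule exec_copy) (use reg s in \<open>auto simp: fun_eq_iff\<close>)
  have 3: "exec (While k ?B) (?s (s i) 0 z0) (?s 0 (s i) y)"
    by (rule z0(2)[rule_format, of 0, unfolded add_0], rule exec.While0) (use reg in auto)
  have 4: "exec (clear (k + 1)) (?s 0 (s i) y) (s(d := y))"
    by (rule exec_clear) (use reg s in \<open>auto simp: fun_eq_iff\<close>)
  show "exec (compile (PrimRec f g) is d k) s (s(d := y))"
    unfolding compile.simps "is" list.sel
    by (rule exec.Seq[OF 1 exec.Seq[OF 2 exec.Seq[OF 3 4]]])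
qed

lemma compiles_to_Mu:
  assumes f: "compiles_to f (compile f)"
  shows "compiles_to (Mu f) (compile (Mu f))"
proof (rule compiles_toI)
  fix "is" :: "nat list" and d k :: nat and s y
  assume ev: "evaluates (Mu f) (map s is) y" and reg: "set is \<subseteq> {..<k}" "d < k" "d \<notin> set is"
    and s: "s d = 0" "\<And>j. j \<ge> k \<Longrightarrow> s j = 0"
  from ev have y: "evaluates f (y # map s is) 0" "\<And>m. m < y \<Longrightarrow> \<exists>z. evaluates f (m # map s is) (Suc z)"
    by (auto elim: evaluates_MuE)
  have val: "\<exists>z. evaluates f (m # map s is) z \<and> (z = 0 \<longleftrightarrow> m = y)" if "m \<le> y" for m
  proof (cases "m = y")
    case False
    then show ?thesis using y(2)[of m] that by (metis le_neq_implies_less nat.distinct(1))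
  qed (use y in blast)
  let ?B = "clear k ;; Inc d ;; compile f (d # is) k (k + 1)"
  let ?s = "\<lambda>m z. s(d := m, k := z)"
  have eval: "exec (compile f (d # is) k (k + 1)) (?s m 0) (?s m z)" if "evaluates f (m # map s is) z" for m z
    by (rule compiles_toD[OF f that]) (use reg s in \<open>auto simp: subset_iff\<close>)
  \<comment> \<open>Descending induction from the least zero \<open>y\<close>: register
    \<open>k\<close> holds the value at the candidate \<open>m\<close>, so the loop stops exactly at
    \<open>m = y\<close>.\<close>
  have loop: "exec (While k ?B) (?s m z) (?s y 0)" if "m \<le> y" "evaluates f (m # map s is) z"
    "z = 0 \<longleftrightarrow> m = y" for m z
    using that
  proof (induction arbitrary: z rule: inc_induct)
    case base
    then have "z = 0" by simp
    then show ?case by (simp add: exec.While0)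
  next
    case (step m)
    then obtain z' where z': "z = Suc z'" by (cases z) auto
    obtain w where w: "evaluates f (Suc m # map s is) w" "w = 0 \<longleftrightarrow> Suc m = y"
      using val[of "Suc m"] step.hyps by auto
    have 1: "exec (clear k) (?s m z') (?s m 0)"
      by (rule exec_clear) (auto simp: fun_eq_iff)
    have 2: "exec (Inc d) (?s m 0) (?s (Suc m) 0)"
      by (rule exec_Inc) (use reg in \<open>auto simp: fun_eq_iff\<close>)
    have 3: "exec ?B (?s m z') (?s (Suc m) w)"
      by (rule exec.Seq[OF 1 exec.Seq[OF 2 eval[OF w(1)]]])
    have IH: "exec (While k ?B) (?s (Suc m) w) (?s y 0)"
      using step.IH[OF w] by (simp add: fun_upd_def)
    have "(?s m z)(k := z') = ?s m z'" by simp
    then have "exec (While k ?B) (?s m z) (?s y 0)"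
      using exec.WhileSuc[OF _ _ IH, of "?s m z" z'] 3 z' by simp
    then show ?case by (simp add: fun_upd_def)
  qed
  obtain z where z: "evaluates f (0 # map s is) z" "z = 0 \<longleftrightarrow> 0 = y"
    using val[of 0] by blast
  have "?s 0 0 = s" "?s y 0 = s(d := y)" using s reg by (auto simp: fun_eq_iff)
  then show "exec (compile (Mu f) is d k) s (s(d := y))"
    using exec.Seq[OF eval[OF z(1)] loop[OF _ z]] by simp
qed

theorem compiles_to_compile: "compiles_to f (compile f)"
proof (induction f)
  case Zr
  show ?case
    by (rule compiles_toI) (auto elim!: evaluates_ZrE intro!: exec_Skip)
next
  case Sc
  show ?case
  proof (rule compiles_toI)
    fix "is" :: "nat list" and d k :: nat and s y
    assume ev: "evaluates Sc (map s is) y" and reg: "set is \<subseteq> {..<k}" "d < k" "d \<notin> set is"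
      and s: "s d = 0" "\<And>j. j \<ge> k \<Longrightarrow> s j = 0"
    from ev obtain i where "is": "is = [i]" "y = Suc (s i)"
      by (auto elim!: evaluates_ScE)
    have "exec (copy i d k) s (s(d := s i))"
      by (rule exec_copy) (use "is" reg s in auto)
    from exec.Seq[OF this exec.Inc[of d]] show "exec (compile Sc is d k) s (s(d := y))"
      using "is" by simp
  qed
next
  case (Proj i)
  show ?case
  proof (rule compiles_toI)
    fix "is" :: "nat list" and d k :: nat and s y
    assume ev: "evaluates (Proj i) (map s is) y" and reg: "set is \<subseteq> {..<k}" "d < k" "d \<notin> set is"
      and s: "s d = 0" "\<And>j. j \<ge> k \<Longrightarrow> s j = 0"
    from ev have i: "i < length is" "y = s (is ! i)"
      by (auto elim!: evaluates_ProjE)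
    then have "is ! i \<in> set is" by simp
    then have "is ! i < k" "is ! i \<noteq> d" using reg by auto
    then show "exec (compile (Proj i) is d k) s (s(d := y))"
      unfolding compile.simps by (intro exec_copy) (use i reg s in auto)
  qed
next
  case (Comp f gs)
  then show ?case by (intro compiles_to_Comp)
next
  case (PrimRec f g)
  then show ?case by (intro compiles_to_PrimRec)
next
  case (Mu f)
  then show ?case by (rule compiles_to_Mu)
qed

section \<open>Unbounded search on three counters\<close>

text \<open>Register 0 holds the input, 1 the next candidate, 2 the answer for the previous one,
  initially 1 so that the search loop is entered.\<close>

definition search_store :: "nat \<Rightarrow> nat \<Rightarrow> nat \<Rightarrow> nat \<Rightarrow> nat" where
  "search_store x y b = (\<lambda>_. 0)(0 := x, 1 := y, 2 := b)"

lemma search_store_simps [simp]: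
  "search_store x y b 2 = b" "(search_store x y b)(2 := b') = search_store x y b'"
  by (auto simp: search_store_def)

definition search_body :: "recf \<Rightarrow> nat prog" where
  "search_body p = (compile p [0, 1] 2 3 ;; Inc 1)"

text \<open>Turns the input \<open>x\<close> into the code of \<open>search_store x 0 1\<close>.\<close>

definition load_prog :: "reg prog" where
  "load_prog = (incs RegC (nth_prime 2) ;;
     While RegA (transfer RegC RegB (nth_prime 0) ;; transfer RegB RegC 1) ;;
     transfer RegC RegA 1)"

text \<open>Independent of the input, hence so are the formulae \<open>E\<close> and
  \<open>D\<close> of the reduction.\<close>

definition search_machine :: "recf \<Rightarrow> nat machine" where
  "search_machine p = machine_of (load_prog ;; tr (While 2 (search_body p)))"

lemma exec_search_body:
  assumes "evaluates p [x, y] b"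
  shows "exec (search_body p) (search_store x y 0) (search_store x (Suc y) b)"
proof -
  have 1: "exec (compile p [0, 1] 2 3) (search_store x y 0) (search_store x y b)"
    by (rule compiles_toD[OF compiles_to_compile assms]) (auto simp: search_store_def fun_eq_iff)
  have 2: "exec (Inc 1) (search_store x y b) (search_store x (Suc y) b)"
    by (rule exec_Inc) (auto simp: search_store_def fun_eq_iff)
  show ?thesis unfolding search_body_def by (rule exec.Seq[OF 1 2])
qed

text \<open>Register \<open>c\<close> starts as prime number 2 and is multiplied \<open>x\<close>
  times by prime number 0, which codes the flag 1 and the input \<open>x\<close>; the candidate 0
  contributes no factor.\<close>

lemma exec_load_prog:
  assumes "K \<ge> 3"
  shows "exec load_prog (store3 x 0 0) (store3 (enc K (search_store x 0 1)) 0 0)"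
proof -
  let ?B = "transfer RegC RegB (nth_prime 0) ;; transfer RegB RegC 1"
  have 1: "exec (incs RegC (nth_prime 2)) (store3 x 0 0) (store3 x 0 (nth_prime 2))"
    by (rule exec_incs) simp
  have body: "exec ?B (store3 a 0 c) (store3 a 0 (nth_prime 0 * c))" for a c
    by (rule exec.Seq[OF exec_transfer exec_transfer]) auto
  have 2: "exec (While RegA ?B) (store3 x 0 c) (store3 0 0 (nth_prime 0 ^ x * c))" for c
  proof (induction x arbitrary: c)
    case 0
    then show ?case by (simp add: exec.While0)
  next
    case (Suc x)
    show ?case
      using exec.WhileSuc[OF _ _ Suc[of "nth_prime 0 * c"], of "store3 (Suc x) 0 c" x] body[of x c]
      by (simp add: mult_ac)
  qed
  have 3: "exec (transfer RegC RegA 1) (store3 0 0 m) (store3 m 0 0)" for m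
    by (rule exec_transfer) auto
  have "enc K (search_store x 0 1) = enc K (((\<lambda>_::nat. 0)(2 := 1 + 0))(0 := x + ((\<lambda>_::nat. 0)(2 := 1 + 0)) 0))"
    by (rule arg_cong[where f = "enc K"]) (auto simp: search_store_def fun_eq_iff)
  also have "\<dots> = nth_prime 0 ^ x * enc K ((\<lambda>_. 0)(2 := 1 + 0))"
    using assms by (intro enc_upd) simp
  also have "enc K ((\<lambda>_. 0)(2 := 1 + 0)) = nth_prime 2"
    using assms enc_upd[of 2 K "\<lambda>_. 0" 1] by (simp add: enc_def)
  finally show ?thesis
    unfolding load_prog_def using exec.Seq[OF 1 exec.Seq[OF 2 3]] by simp
qed

lemma initial_store3: "(\<lambda>r. 0)(RegA := x) = store3 x 0 0"
  by (rule store3_eqI) auto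

lemma search_bound: "\<exists>K\<ge>3. set_prog (While 2 (search_body p)) \<subseteq> {..<K}"
proof -
  obtain N where N: "set_prog (While 2 (search_body p)) \<subseteq> {..<N}"
    using finite_set_prog finite_nat_bounded by blast
  then show ?thesis by (intro exI[of _ "max 3 N"]) auto
qed

lemma halts_search_machine:
  assumes p: "\<And>y. evaluates p [x, y] (if R y then 1 else 0)" and y: "\<not> R y"
  shows "halts (search_machine p) x"
proof -
  obtain K where K: "K \<ge> 3" "set_prog (While 2 (search_body p)) \<subseteq> {..<K}" using search_bound by blast
  define m where "m = (LEAST y. \<not> R y)"
  have m: "\<not> R m" "\<And>y. y < m \<Longrightarrow> R y"
    unfolding m_def using LeastI[of "\<lambda>y. \<not> R y", OF y] not_less_Least by blast+
  \<comment> \<open>All answers before the least counterexample \<open>m\<close> are 1. The final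
    candidate is \<open>Suc m\<close> because it is advanced before the answer is tested.\<close>
  have "exec (While 2 (search_body p)) (search_store x y 1) (search_store x (Suc m) 0)" if "y \<le> m" for y
    using that
  proof (induction rule: inc_induct)
    case base
    have stop: "exec (While 2 (search_body p)) (search_store x (Suc m) 0) (search_store x (Suc m) 0)"
      by (rule exec.While0) simp
    show ?case
      by (rule exec.WhileSuc[OF _ _ stop, where n = 0])
        (use exec_search_body[OF p, of m] m in simp_all)
  next
    case (step y)
    show ?case
      by (rule exec.WhileSuc[OF _ _ step.IH, where n = 0])
        (use exec_search_body[OF p, of y] m(2)[OF step.hyps(2)] in simp_all)
  qed
  from this[of 0] have "exec (While 2 (search_body p)) (search_store x 0 1) (search_store x (Suc m) 0)" by simp
  from exec.Seq[OF exec_load_prog[OF K(1)] exec_tr[OF this K(2)]] show ?thesis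
    unfolding search_machine_def by (intro halts_machine_of) (simp only: initial_store3)
qed

text \<open>\<open>exec_tr\<close> covers terminating programs only, so the translated loop is
  opened: each round terminates and is simulated, and the codes of all stores with flag 1 form the
  invariant.\<close>

lemma runs_forever_search_machine:
  assumes p: "\<And>y. evaluates p [x, y] (if R y then 1 else 0)" and R: "\<And>y. R y"
  shows "runs_forever (search_machine p) x"
proof -
  obtain K where K: "K \<ge> 3" "set_prog (While 2 (search_body p)) \<subseteq> {..<K}" using search_bound by blast
  let ?S = "range (\<lambda>y. store3 (enc K (search_store x y 1)) 1 0)"
  let ?B = "div_prog (nth_prime 2) ;; tr (search_body p) ;; dvd_prog (nth_prime 2)"
  have test: "exec (dvd_prog (nth_prime 2)) (store3 (enc K (search_store x y 1)) 0 0)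
      (store3 (enc K (search_store x y 1)) 1 0)" for y
    using exec_tr_test[of 2 K "search_store x y 1"] K(1) by simp
  have body: "exec ?B (store3 (enc K (search_store x y 1)) 0 0) (store3 (enc K (search_store x (Suc y) 1)) 1 0)" for y
  proof -
    have 1: "exec (div_prog (nth_prime 2)) (store3 (enc K (search_store x y 1)) 0 0)
        (store3 (enc K (search_store x y 0)) 0 0)"
      using exec_tr_dec[of 2 K "search_store x y 1" 0] K(1) by simp
    have "exec (search_body p) (search_store x y 0) (search_store x (Suc y) 1)"
      using exec_search_body[OF p, of y] R by simp
    then have 2: "exec (tr (search_body p)) (store3 (enc K (search_store x y 0)) 0 0)
        (store3 (enc K (search_store x (Suc y) 1)) 0 0)"
      by (rule exec_tr) (use K in simp)
    show ?thesis by (rule exec.Seq[OF 1 exec.Seq[OF 2 test]])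
  qed
  have "diverges (While RegB ?B) (store3 (enc K (search_store x 0 1)) 1 0)"
  proof (rule diverges_While[where S = ?S])
    fix s assume "s \<in> ?S"
    then obtain y where y: "s = store3 (enc K (search_store x y 1)) 1 0" by blast
    show "\<exists>n t. s RegB = Suc n \<and> exec ?B (s(RegB := n)) t \<and> t \<in> ?S"
      by (rule exI[of _ 0], rule exI[of _ "store3 (enc K (search_store x (Suc y) 1)) 1 0"])
        (use body[of y] y in simp)
  qed blast
  then have "diverges (load_prog ;; tr (While 2 (search_body p))) (store3 x 0 0)"
    unfolding tr.simps by (rule diverges_Seq[OF exec_load_prog[OF K(1)] diverges_Seq[OF test]])
  then show ?thesis
    unfolding search_machine_def by (intro runs_forever_machine_of) (simp only: initial_store3)
qed

lemma runs_forever_search_machine_iff: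
  assumes "\<And>y. evaluates p [x, y] (if R y then 1 else 0)"
  shows "runs_forever (search_machine p) x \<longleftrightarrow> (\<forall>y. R y)"
  using halts_search_machine[of p x R] runs_forever_search_machine[of p x R] assms
  unfolding runs_forever_def by blast

section \<open>The reduction is computable\<close>

lemma evaluates_Comp1: "evaluates g xs y \<Longrightarrow> evaluates f [y] z \<Longrightarrow> evaluates (Comp f [g]) xs z"
  by (rule evaluates.intros(4)[of _ _ "[y]"]) auto

lemma evaluates_Comp2:
  "evaluates g xs y \<Longrightarrow> evaluates h xs y' \<Longrightarrow> evaluates f [y, y'] z \<Longrightarrow> evaluates (Comp f [g, h]) xs z"
  by (rule evaluates.intros(4)[of _ _ "[y, y']"]) auto

lemma evaluates_Proj: "i < length xs \<Longrightarrow> y = xs ! i \<Longrightarrow> evaluates (Proj i) xs y"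
  by (simp add: evaluates.intros(3))

primrec const_recf :: "nat \<Rightarrow> recf" where
  "const_recf 0 = Zr"
| "const_recf (Suc n) = Comp Sc [const_recf n]"

lemma evaluates_const: "evaluates (const_recf n) xs n"
  by (induction n) (auto intro: evaluates.intros(1,2) evaluates_Comp1)

definition add_recf :: recf where
  "add_recf = PrimRec (Proj 0) (Comp Sc [Proj 1])"

lemma evaluates_add: "evaluates add_recf [m, n] (m + n)"
  unfolding add_recf_def
proof (induction m)
  case 0
  show ?case by (rule evaluates.intros(5), rule evaluates_Proj) simp_all
next
  case (Suc m)
  then show ?case
    by (intro evaluates.intros(6)[OF Suc] evaluates_Comp1[OF evaluates_Proj]) (auto intro: evaluates.intros(2))
qed

definition triangle_recf :: recf where
  "triangle_recf = PrimRec Zr (Comp Sc [Comp add_recf [Proj 0, Proj 1]])"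

lemma evaluates_triangle: "evaluates triangle_recf [n] (triangle n)"
  unfolding triangle_recf_def
proof (induction n)
  case (Suc n)
  have "evaluates (Comp Sc [Comp add_recf [Proj 0, Proj 1]]) [n, triangle n] (Suc (n + triangle n))"
    by (intro evaluates_Comp1[OF evaluates_Comp2[OF evaluates_Proj evaluates_Proj evaluates_add]])
      (auto intro: evaluates.intros(2))
  from evaluates.intros(6)[OF Suc this] show ?case by (simp add: add_ac)
qed (auto intro: evaluates.intros(1,5))

text \<open>Cantor pairing, \<open>triangle (m + n) + m\<close>.\<close>

definition pair_recf :: recf where
  "pair_recf = Comp add_recf [Comp triangle_recf [add_recf], Proj 0]"

lemma evaluates_pair: "evaluates pair_recf [m, n] (prod_encode (m, n))"
  unfolding pair_recf_def prod_encode_def prod.case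
  by (rule evaluates_Comp2[OF evaluates_Comp1[OF evaluates_add evaluates_triangle] evaluates_Proj evaluates_add])
    auto

text \<open>Prepending one formula to a list is a fixed operation on its code, a pairing followed by
  a successor; iterating it \<open>x\<close> times is a primitive recursion.\<close>

lemma computable_sequent_code: "computable (\<lambda>x. sequent_code (replicate x A @ \<Gamma>) C)"
proof -
  let ?g = "Comp Sc [Comp pair_recf [const_recf (fm_code A), Proj 1]]"
  let ?h = "PrimRec (const_recf (list_encode (map fm_code \<Gamma>))) ?g"
  have "evaluates ?h [x] (list_encode (map fm_code (replicate x A @ \<Gamma>)))" for x
  proof (induction x)
    case 0
    then show ?case by (auto intro: evaluates.intros(5) evaluates_const)
  next
    case (Suc x)
    let ?r = "list_encode (map fm_code (replicate x A @ \<Gamma>))"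
    have "evaluates ?g [x, ?r] (Suc (prod_encode (fm_code A, ?r)))"
      by (rule evaluates_Comp1[OF evaluates_Comp2[OF evaluates_const evaluates_Proj evaluates_pair]])
        (auto intro: evaluates.intros(2))
    from evaluates.intros(6)[OF Suc this] show ?case by simp
  qed
  then have "evaluates (Comp pair_recf [?h, const_recf (fm_code C)]) [x]
      (sequent_code (replicate x A @ \<Gamma>) C)" for x
    unfolding sequent_code_def by (intro evaluates_Comp2[OF _ evaluates_const evaluates_pair])
  then show ?thesis unfolding computable_def by blast
qed

section \<open>Codes determine sequents\<close>

lemma inj_fm_code: "fm_code A = fm_code B \<Longrightarrow> A = B"
  by (induction A arbitrary: B) (case_tac B; simp)+

text \<open>Membership only says that some derivable sequent has this code; injectivity recovers the
  list and with it the multiset.\<close>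

lemma sequent_code_in_derivability_problem:
  "sequent_code As C \<in> derivability_problem \<longleftrightarrow> mset As \<turnstile> C"
proof
  assume "sequent_code As C \<in> derivability_problem"
  then obtain As' C' where *: "sequent_code As C = sequent_code As' C'" "mset As' \<turnstile> C'"
    unfolding derivability_problem_def by blast
  then have "map fm_code As = map fm_code As'" "fm_code C = fm_code C'"
    unfolding sequent_code_def by (auto dest: list_encode_eq[THEN iffD1])
  moreover have "inj fm_code" using inj_fm_code by (auto intro: injI)
  ultimately show "mset As \<turnstile> C" using *(2) inj_fm_code[of C C'] by (simp add: inj_map_eq_map)
qed (auto simp: derivability_problem_def)

fun role_index :: "nat role \<Rightarrow> nat" where
  "role_index (Reg RegA) = 0"
| "role_index (Reg RegB) = 1"
| "role_index (Reg RegC) = 2"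
| "role_index (ZTest RegA) = 3"
| "role_index (ZTest RegB) = 4"
| "role_index (ZTest RegC) = 5"
| "role_index (State q) = q + 6"

lemma inj_role_index: "inj role_index"
proof (rule injI)
  show "\<rho> = \<sigma>" if "role_index \<rho> = role_index \<sigma>" for \<rho> \<sigma>
    using that by (cases \<rho> rule: role_index.cases; cases \<sigma> rule: role_index.cases) auto
qed

theorem Pi01_hard_derivability_problem: "Pi01_hard derivability_problem"
  unfolding Pi01_hard_def
proof (intro allI impI)
  fix S assume "Pi01 S"
  then obtain R p where S: "S = {x. \<forall>y. R x y}" and p: "\<And>x y. evaluates p [x, y] (if R x y then 1 else 0)"
    unfolding Pi01_def decidable_rel_def by blast
  let ?M = "search_machine p"
  have M: "det_machine ?M" unfolding search_machine_def by (rule det_machine_machine_of)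
  then obtain ins qs where ins: "set ins = instrs ?M" and qs: "set qs = states ?M"
    unfolding det_machine_def by (metis finite_list)
  have v: "distinct_vars ?M role_index"
    unfolding distinct_vars_def using inj_role_index by (rule inj_on_subset) simp
  \<comment> \<open>The copies stand in front to fit \<open>computable_sequent_code\<close>; the
    order does not affect the sequent.\<close>
  let ?As = "\<lambda>x. replicate x (reg_var role_index RegA) @ [Star (E_fm role_index ins), state_var role_index (init ?M)]"
  let ?C = "D_fm role_index qs"
  have "x \<in> S \<longleftrightarrow> sequent_code (?As x) ?C \<in> derivability_problem" for x
  proof -
    have "x \<in> S \<longleftrightarrow> runs_forever ?M x"
      unfolding S using runs_forever_search_machine_iff[of p x "R x", OF p] by simp
    also have "\<dots> \<longleftrightarrow> mset (?As x) \<turnstile> ?C"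
      using runs_forever_iff_derivable[OF M v ins qs, of x] by (simp add: add.commute)
    finally show ?thesis unfolding sequent_code_in_derivability_problem .
  qed
  then show "many_one_reducible S derivability_problem"
    unfolding many_one_reducible_def using computable_sequent_code by blast
qed

theorem theorem6:
  shows "(\<forall>(M :: 'q machine) v ins qs x.
            det_machine M \<and> distinct_vars M v \<and>
            distinct ins \<and> set ins = instrs M \<and> distinct qs \<and> set qs = states M \<longrightarrow>
            (runs_forever M x \<longleftrightarrow>
              {#Star (E_fm v ins), state_var v (init M)#} + replicate_mset x (reg_var v RegA)
                \<turnstile> D_fm v qs))
         \<and> Pi01_hard derivability_problem"
  using runs_forever_iff_derivable Pi01_hard_derivability_problem by blast

end
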